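(* Let $A$ be a finite-dimensional algebra over a field $k$, $Q$ a finite acyclic quiver, $I$ an ideal of $kQ$ generated by monomial relations, and $\Lambda=A\otimes_k kQ/I$. Let $X=(X_i,X_\alpha,i\in Q_0,\alpha\in Q_1)$ be a monic $\Lambda$-module, and let $p$ be a non-zero path with $l(p)\ge1$. Then: (1) $\operatorname{Ker}X_p=\sum_{q\in K_p}\operatorname{Im}X_q$, where $K_p=\{q\text{ a path}: e(q)=s(p),\ l(q)\ge 1,\ q\notin I,\ pq\in I\}$. Thus, if $s(p)$ is a source then $X_p$ is injective. (2) $\operatorname{Ker}X_p=\big(\bigoplus_{\beta\in B_1}\operatorname{Im}X_\beta\big)\oplus\big(\bigoplus_{\beta\in B_2}X_\beta(\operatorname{Ker}X_{p\beta})\big)$, where $$B_1=\{\beta\in\mathcal A(\to s(p)) : \beta=\mathrm{la}(q)\text{ for some }q\in\mathcal P(\to s(p)),\ p\beta\in I\},$$ $$B_2=\{\beta\in\mathcal A(\to s(p)) : \beta=\mathrm{la}(q)\text{ for some }q\in\mathcal P(\to s(p)),\ p\beta\notin I,\ pq\in I\}.$$ (If $B_1=\emptyset=B_2$, this says that $X_p$ is injective.) (3) If $j$ and $i$ are distinct vertices of $Q$, then the sum $\sum_{q\in\mathcal P(j\to i)}\operatorname{Im}X_q$ of submodules of $X_i$ is direct, i.e. $\sum_{q\in\mathcal P(j\to i)}\operatorname{Im}X_q=\bigoplus_{q\in\mathcal P(j\to i)}\operatorname{Im}X_q$.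
   Context: Throughout, $k$ is a field, $A$ is a finite-dimensional $k$-algebra, modules are finitely generated left modules, $Q=(Q_0,Q_1)$ is a finite acyclic quiver, and $I$ is an ideal of the path algebra $kQ$ generated by a set of paths of length at least $2$ (monomial relations), with minimal generating set of paths $\rho=\{\rho_1,\dots,\rho_t\}$. For an arrow or path $p$, $s(p)$, $e(p)$ are its starting and ending vertices and $l(p)$ its length; paths are composed from right to left; $p$ is non-zero if $p\notin I$. If $q=\beta q'$ with $\beta\in Q_1$, then $\beta$ is the last arrow of $q$, written $\mathrm{la}(q)=\beta$. For vertices $i,j$: $\mathcal A(\to i)=\{\alpha\in Q_1: e(\alpha)=i\}$; $\mathcal P(\to i)=\{\text{paths }p: e(p)=i,\ l(p)\ge1,\ p\notin I\}$; $\mathcal P(j\to i)=\{\text{paths }p: s(p)=j,\ e(p)=i,\ l(p)\ge1,\ p\notin I\}$. A representation of $(Q,I)$ over $A$ is a datum $X=(X_i,X_\alpha,i\in Q_0,\alpha\in Q_1)$ with each $X_i$ a finitely generated $A$-module and each $X_\alpha:X_{s(\alpha)}\to X_{e(\alpha)}$ an $A$-map, such that $X_{\rho_j}=0$ for all $j$, where for a path $p=\alpha_l\cdots\alpha_1$ one puts $X_p=X_{\alpha_l}\cdots X_{\alpha_1}$. $\Lambda$-modules are identified with representations of $(Q,I)$ over $A$. A representation $X$ (equivalently a $\Lambda$-module) is monic if: (m1) for each $i\in Q_0$ the sum $\sum_{\alpha\in \mathcal A(\to i)}\operatorname{Im}X_\alpha$ of submodules of $X_i$ is direct (indexed by arrows);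 and (m2) for each $\alpha\in Q_1$, $\operatorname{Ker}X_\alpha=\sum_{q\in K_\alpha}\operatorname{Im}X_q$, where $K_\alpha=\{q\in\mathcal P(\to s(\alpha)):\alpha q\in I\}$ (an empty sum is $0$). *)

theory Defs
  imports "HOL-Algebra.Ideal" "HOL-Algebra.Module" "Graph_Theory.Arc_Walk"
begin

section \<open>Algebras and left modules\<close>

text \<open>
  The library's \<^locale>\<open>Module.module\<close> and \<^locale>\<open>Module.algebra\<close> are about commutative
  rings; \<open>left_module\<close> has the axioms of \<^locale>\<open>Module.module\<close> over an arbitrary ring.
\<close>

locale left_module = R?: ring R + M?: abelian_group M
  for R :: "('a, 'r) ring_scheme" and M :: "('a, 'x, 'm) module_scheme" (structure) +
  assumes smult_closed:
      "\<lbrakk>a \<in> carrier R; x \<in> carrier M\<rbrakk> \<Longrightarrow> a \<odot>\<^bsub>M\<^esub> x \<in> carrier M"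
    and smult_l_distr:
      "\<lbrakk>a \<in> carrier R; b \<in> carrier R; x \<in> carrier M\<rbrakk> \<Longrightarrow>
        (a \<oplus>\<^bsub>R\<^esub> b) \<odot>\<^bsub>M\<^esub> x = a \<odot>\<^bsub>M\<^esub> x \<oplus>\<^bsub>M\<^esub> b \<odot>\<^bsub>M\<^esub> x"
    and smult_r_distr:
      "\<lbrakk>a \<in> carrier R; x \<in> carrier M; y \<in> carrier M\<rbrakk> \<Longrightarrow>
        a \<odot>\<^bsub>M\<^esub> (x \<oplus>\<^bsub>M\<^esub> y) = a \<odot>\<^bsub>M\<^esub> x \<oplus>\<^bsub>M\<^esub> a \<odot>\<^bsub>M\<^esub> y"
    and smult_assoc1:
      "\<lbrakk>a \<in> carrier R; b \<in> carrier R; x \<in> carrier M\<rbrakk> \<Longrightarrow>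
        (a \<otimes>\<^bsub>R\<^esub> b) \<odot>\<^bsub>M\<^esub> x = a \<odot>\<^bsub>M\<^esub> (b \<odot>\<^bsub>M\<^esub> x)"
    and smult_one:
      "x \<in> carrier M \<Longrightarrow> \<one>\<^bsub>R\<^esub> \<odot>\<^bsub>M\<^esub> x = x"

definition fin_generated :: "('a, 'r) ring_scheme \<Rightarrow> ('a, 'x, 'm) module_scheme \<Rightarrow> bool" where
  "fin_generated R M \<longleftrightarrow>
    (\<exists>S. finite S \<and> S \<subseteq> carrier M \<and>
      (\<forall>x \<in> carrier M. \<exists>c \<in> S \<rightarrow> carrier R. x = (\<Oplus>\<^bsub>M\<^esub> s\<in>S. c s \<odot>\<^bsub>M\<^esub> s)))"

text \<open>
  A finite-dimensional unital associative \<open>k\<close>-algebra, not necessarily commutative. The structure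
  \<open>A\<close> carries the ring operations and the action of \<open>k\<close>.
\<close>

locale fd_algebra = K?: field k + A?: ring A + vec?: Module.module k A
  for k :: "('k, 'l) ring_scheme" and A :: "('k, 'a, 'm) module_scheme" (structure) +
  assumes smult_mult_left:
      "\<lbrakk>c \<in> carrier k; x \<in> carrier A; y \<in> carrier A\<rbrakk> \<Longrightarrow>
        (c \<odot>\<^bsub>A\<^esub> x) \<otimes>\<^bsub>A\<^esub> y = c \<odot>\<^bsub>A\<^esub> (x \<otimes>\<^bsub>A\<^esub> y)"
    and smult_mult_right:
      "\<lbrakk>c \<in> carrier k; x \<in> carrier A; y \<in> carrier A\<rbrakk> \<Longrightarrow>
        x \<otimes>\<^bsub>A\<^esub> (c \<odot>\<^bsub>A\<^esub> y) = c \<odot>\<^bsub>A\<^esub> (x \<otimes>\<^bsub>A\<^esub> y)"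
    and finite_dimensional: "fin_generated k A"

definition module_maps ::
  "('a, 'r) ring_scheme \<Rightarrow> ('a, 'x, 'm) module_scheme \<Rightarrow> ('a, 'y, 'n) module_scheme \<Rightarrow> ('x \<Rightarrow> 'y) set"
  where
  "module_maps R M N =
    {h \<in> carrier M \<rightarrow> carrier N.
      (\<forall>x \<in> carrier M. \<forall>y \<in> carrier M. h (x \<oplus>\<^bsub>M\<^esub> y) = h x \<oplus>\<^bsub>N\<^esub> h y) \<and>
      (\<forall>a \<in> carrier R. \<forall>x \<in> carrier M. h (a \<odot>\<^bsub>M\<^esub> x) = a \<odot>\<^bsub>N\<^esub> h x)}"

text \<open>
  Sums of indexed families of submodules \<open>N q\<close> (\<open>q \<in> K\<close>) of \<open>M\<close>, and directness of such a sum as an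
  indexed family. The finite subsets \<open>F\<close> are only there because \<^const>\<open>finsum\<close> over an infinite index
  set is a dummy value.
\<close>

definition submodule_sum :: "('a, 'x, 'm) module_scheme \<Rightarrow> 'q set \<Rightarrow> ('q \<Rightarrow> 'x set) \<Rightarrow> 'x set" where
  "submodule_sum M K N = {finsum M x F | F x. finite F \<and> F \<subseteq> K \<and> x \<in> Pi F N}"

definition direct_family :: "('a, 'x, 'm) module_scheme \<Rightarrow> 'q set \<Rightarrow> ('q \<Rightarrow> 'x set) \<Rightarrow> bool" where
  "direct_family M K N \<longleftrightarrow>
    (\<forall>F x. finite F \<and> F \<subseteq> K \<and> x \<in> Pi F N \<and> finsum M x F = \<zero>\<^bsub>M\<^esub> \<longrightarrow> (\<forall>q \<in> F. x q = \<zero>\<^bsub>M\<^esub>))"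

section \<open>Quivers, paths and the path algebra\<close>

text \<open>
  A finite quiver is a \<^locale>\<open>fin_digraph\<close> (loops and parallel arrows allowed). The path
  \<open>\<alpha>\<^sub>l \<dots> \<alpha>\<^sub>1\<close> starting at \<open>u\<close>, composed from right to left, is the pair \<open>(u, [\<alpha>\<^sub>1, \<dots>, \<alpha>\<^sub>l])\<close>; the
  list is in the order of traversal, and \<open>(u, [])\<close> is the trivial path at \<open>u\<close>.
\<close>

type_synonym ('v, 'e) qpath = "'v \<times> 'e list"

definition acyclic_quiver :: "('v, 'e) pre_digraph \<Rightarrow> bool" where
  "acyclic_quiver Q \<longleftrightarrow> fin_digraph Q \<and> (\<nexists>c. pre_digraph.cycle Q c)"

definition paths :: "('v, 'e) pre_digraph \<Rightarrow> ('v, 'e) qpath set" where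
  "paths Q = {p. \<exists>v. pre_digraph.awalk Q (fst p) (snd p) v}"

definition psrc :: "('v, 'e) qpath \<Rightarrow> 'v" where
  "psrc p = fst p"

definition ptgt :: "('v, 'e) pre_digraph \<Rightarrow> ('v, 'e) qpath \<Rightarrow> 'v" where
  "ptgt Q p = pre_digraph.awlast Q (fst p) (snd p)"

definition plen :: "('v, 'e) qpath \<Rightarrow> nat" where
  "plen p = length (snd p)"

text \<open>\<open>pcomp p q\<close> is the path \<open>p q\<close>, first \<open>q\<close> and then \<open>p\<close>; it is meant for \<open>psrc p = ptgt Q q\<close>.\<close>

definition pcomp :: "('v, 'e) qpath \<Rightarrow> ('v, 'e) qpath \<Rightarrow> ('v, 'e) qpath" where
  "pcomp p q = (fst q, snd q @ snd p)"

definition arrow_path :: "('v, 'e) pre_digraph \<Rightarrow> 'e \<Rightarrow> ('v, 'e) qpath" where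
  "arrow_path Q \<alpha> = (tail Q \<alpha>, [\<alpha>])"

definition last_arrow :: "('v, 'e) qpath \<Rightarrow> 'e" where
  "last_arrow p = last (snd p)"

text \<open>
  \<open>k Q\<close> consists of the finitely supported \<open>k\<close>-valued functions on the set of paths, extended by
  zero; the product of two paths is their composite if they are composable and zero otherwise.
\<close>

definition path_algebra ::
  "('k, 'l) ring_scheme \<Rightarrow> ('v, 'e) pre_digraph \<Rightarrow> ('k, ('v, 'e) qpath \<Rightarrow> 'k) module" where
  "path_algebra k Q =
    \<lparr> carrier = {f. (\<forall>p \<in> paths Q. f p \<in> carrier k) \<and> (\<forall>p. p \<notin> paths Q \<longrightarrow> f p = \<zero>\<^bsub>k\<^esub>) \<and>
                    finite {p. f p \<noteq> \<zero>\<^bsub>k\<^esub>}},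
      monoid.mult = (\<lambda>f g r.
        finsum k (\<lambda>(p, q). f p \<otimes>\<^bsub>k\<^esub> g q)
          {(p, q). p \<in> paths Q \<and> q \<in> paths Q \<and> psrc p = ptgt Q q \<and> pcomp p q = r}),
      monoid.one = (\<lambda>r. if r \<in> paths Q \<and> plen r = 0 then \<one>\<^bsub>k\<^esub> else \<zero>\<^bsub>k\<^esub>),
      ring.zero = (\<lambda>r. \<zero>\<^bsub>k\<^esub>),
      ring.add = (\<lambda>f g r. f r \<oplus>\<^bsub>k\<^esub> g r),
      module.smult = (\<lambda>c f r. c \<otimes>\<^bsub>k\<^esub> f r) \<rparr>"

definition path_elt :: "('k, 'l) ring_scheme \<Rightarrow> ('v, 'e) qpath \<Rightarrow> ('v, 'e) qpath \<Rightarrow> 'k" where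
  "path_elt k p = (\<lambda>r. if r = p then \<one>\<^bsub>k\<^esub> else \<zero>\<^bsub>k\<^esub>)"

text \<open>
  \<open>rho\<close> is a minimal set of paths generating \<open>I\<close> as a two-sided ideal of \<open>k Q\<close>, and all its members
  have length at least two.
\<close>

definition monomial_ideal ::
  "('k, 'l) ring_scheme \<Rightarrow> ('v, 'e) pre_digraph \<Rightarrow> (('v, 'e) qpath \<Rightarrow> 'k) set \<Rightarrow> ('v, 'e) qpath set \<Rightarrow> bool"
  where
  "monomial_ideal k Q I rho \<longleftrightarrow>
    rho \<subseteq> {p \<in> paths Q. plen p \<ge> 2} \<and>
    I = Idl\<^bsub>path_algebra k Q\<^esub> (path_elt k ` rho) \<and>
    (\<forall>rho'. rho' \<subset> rho \<longrightarrow> Idl\<^bsub>path_algebra k Q\<^esub> (path_elt k ` rho') \<noteq> I)"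

text \<open>The sets \<open>\<P>(\<rightarrow> i)\<close> and \<open>\<P>(j \<rightarrow> i)\<close>; the set \<open>\<A>(\<rightarrow> i)\<close> is \<^term>\<open>in_arcs Q i\<close>.\<close>

definition nz_paths_to ::
  "('k, 'l) ring_scheme \<Rightarrow> ('v, 'e) pre_digraph \<Rightarrow> (('v, 'e) qpath \<Rightarrow> 'k) set \<Rightarrow> 'v \<Rightarrow> ('v, 'e) qpath set"
  where
  "nz_paths_to k Q I i = {p \<in> paths Q. ptgt Q p = i \<and> plen p \<ge> 1 \<and> path_elt k p \<notin> I}"

definition nz_paths_from_to ::
  "('k, 'l) ring_scheme \<Rightarrow> ('v, 'e) pre_digraph \<Rightarrow> (('v, 'e) qpath \<Rightarrow> 'k) set \<Rightarrow> 'v \<Rightarrow> 'v \<Rightarrow> ('v, 'e) qpath set"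
  where
  "nz_paths_from_to k Q I j i =
    {p \<in> paths Q. psrc p = j \<and> ptgt Q p = i \<and> plen p \<ge> 1 \<and> path_elt k p \<notin> I}"

section \<open>Representations\<close>

text \<open>
  The underlying sets of the modules at the vertices are arbitrary subsets of one type \<open>'x\<close>. This is
  no restriction: any family of modules can be transported into a common type.
\<close>

record ('v, 'e, 'a, 'x) quiver_rep =
  vmod :: "'v \<Rightarrow> ('a, 'x) module"
  amap :: "'e \<Rightarrow> 'x \<Rightarrow> 'x"

definition pmap :: "('v, 'e, 'a, 'x) quiver_rep \<Rightarrow> ('v, 'e) qpath \<Rightarrow> 'x \<Rightarrow> 'x" where
  "pmap X p = fold (amap X) (snd p)"

definition quiver_representation ::
  "('a, 'r) ring_scheme \<Rightarrow> ('v, 'e) pre_digraph \<Rightarrow> ('v, 'e) qpath set \<Rightarrow> ('v, 'e, 'a, 'x) quiver_rep \<Rightarrow> bool"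
  where
  "quiver_representation A Q rho X \<longleftrightarrow>
    (\<forall>i \<in> verts Q. left_module A (vmod X i) \<and> fin_generated A (vmod X i)) \<and>
    (\<forall>\<alpha> \<in> arcs Q. amap X \<alpha> \<in> module_maps A (vmod X (tail Q \<alpha>)) (vmod X (head Q \<alpha>))) \<and>
    (\<forall>p \<in> rho. \<forall>x \<in> carrier (vmod X (psrc p)). pmap X p x = \<zero>\<^bsub>vmod X (ptgt Q p)\<^esub>)"

definition im_path :: "('v, 'e, 'a, 'x) quiver_rep \<Rightarrow> ('v, 'e) qpath \<Rightarrow> 'x set" where
  "im_path X p = pmap X p ` carrier (vmod X (psrc p))"

definition ker_path ::
  "('v, 'e) pre_digraph \<Rightarrow> ('v, 'e, 'a, 'x) quiver_rep \<Rightarrow> ('v, 'e) qpath \<Rightarrow> 'x set" where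
  "ker_path Q X p = a_kernel (vmod X (psrc p)) (vmod X (ptgt Q p)) (pmap X p)"

definition monic_rep ::
  "('k, 'l) ring_scheme \<Rightarrow> ('v, 'e) pre_digraph \<Rightarrow> (('v, 'e) qpath \<Rightarrow> 'k) set \<Rightarrow>
    ('v, 'e, 'a, 'x) quiver_rep \<Rightarrow> bool" where
  "monic_rep k Q I X \<longleftrightarrow>
    (\<forall>i \<in> verts Q. direct_family (vmod X i) (in_arcs Q i) (\<lambda>\<alpha>. im_path X (arrow_path Q \<alpha>))) \<and>
    (\<forall>\<alpha> \<in> arcs Q.
      ker_path Q X (arrow_path Q \<alpha>) =
        submodule_sum (vmod X (tail Q \<alpha>))
          {q \<in> nz_paths_to k Q I (tail Q \<alpha>). path_elt k (pcomp (arrow_path Q \<alpha>) q) \<in> I} (im_path X))"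

definition kernel_paths ::
  "('k, 'l) ring_scheme \<Rightarrow> ('v, 'e) pre_digraph \<Rightarrow> (('v, 'e) qpath \<Rightarrow> 'k) set \<Rightarrow> ('v, 'e) qpath \<Rightarrow>
    ('v, 'e) qpath set" where
  "kernel_paths k Q I p =
    {q \<in> paths Q. ptgt Q q = psrc p \<and> plen q \<ge> 1 \<and> path_elt k q \<notin> I \<and> path_elt k (pcomp p q) \<in> I}"

definition B1 ::
  "('k, 'l) ring_scheme \<Rightarrow> ('v, 'e) pre_digraph \<Rightarrow> (('v, 'e) qpath \<Rightarrow> 'k) set \<Rightarrow> ('v, 'e) qpath \<Rightarrow> 'e set"
  where
  "B1 k Q I p =
    {\<beta> \<in> in_arcs Q (psrc p).
      \<exists>q \<in> nz_paths_to k Q I (psrc p).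
        \<beta> = last_arrow q \<and> path_elt k (pcomp p (arrow_path Q \<beta>)) \<in> I}"

definition B2 ::
  "('k, 'l) ring_scheme \<Rightarrow> ('v, 'e) pre_digraph \<Rightarrow> (('v, 'e) qpath \<Rightarrow> 'k) set \<Rightarrow> ('v, 'e) qpath \<Rightarrow> 'e set"
  where
  "B2 k Q I p =
    {\<beta> \<in> in_arcs Q (psrc p).
      \<exists>q \<in> nz_paths_to k Q I (psrc p).
        \<beta> = last_arrow q \<and> path_elt k (pcomp p (arrow_path Q \<beta>)) \<notin> I \<and> path_elt k (pcomp p q) \<in> I}"

end

theory Submission
  imports Defs "HOL-Library.Sublist"
begin

text \<open>
  A path lies in the monomial ideal \<open>I\<close> iff it has a subpath in \<open>rho\<close>, so that all conditions of the
  form \<open>p \<in> I\<close> become conditions on lists of arrows.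

  The sum of the images \<open>Im X\<^sub>q\<close> with \<open>q \<in> K\<^sub>p\<close> splits along the last arrows of the \<open>q\<close>: its elements are
  \<open>\<Sum> X\<^sub>\<beta> y\<^sub>\<beta>\<close>, where \<open>y\<^sub>\<beta>\<close> lies in the sum for \<open>p \<beta>\<close> unless \<open>p \<beta> \<in> I\<close>. As the sum of the images of the
  arrows is direct, induction on the length of \<open>p\<close> gives (1), and then (2). It also follows that
  \<open>X\<^sub>p (\<Sum> X\<^sub>\<beta> z\<^sub>\<beta>) = 0\<close> implies \<open>X\<^sub>p X\<^sub>\<beta> z\<^sub>\<beta> = 0\<close> for each \<open>\<beta>\<close>. Iterating this along the arrows of the paths
  from \<open>j\<close> to \<open>i\<close> gives (3); the iteration stops at \<open>j\<close> because \<open>Q\<close> has no cycles.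
\<close>

section \<open>The path algebra and its monomial ideals\<close>

text \<open>The components \<open>y\<^sub>\<beta>\<close> are taken in the module at the tail of the
  arrow, and (m1) determines only the images \<open>X\<^sub>\<beta> y\<^sub>\<beta>\<close>, hence
  \<open>y\<^sub>\<beta>\<close> up to \<open>Ker X\<^sub>\<beta>\<close>. This ambiguity is what
  (m2) repairs: in the induction for (1), where \<open>p\<close> begins with \<open>\<beta>\<close>,
  directness at the end of \<open>\<beta>\<close> replaces \<open>x\<close> by some \<open>y\<close>
  in the sum for \<open>p\<close> with the same image under \<open>X\<^sub>\<beta>\<close>, and (m2)
  at the start of \<open>\<beta>\<close> handles \<open>x - y\<close>.

  In (3), directness at \<open>i\<close> separates paths only by their last arrows. To separate two
  paths with the same last arrow \<open>\<beta>\<close> one has to move to the tail of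
  \<open>\<beta>\<close>, but \<open>X\<^sub>\<beta>\<close> need not be injective: there the
  partial sum is not known to vanish, only its image under \<open>X\<^sub>\<beta>\<close>. So the
  statement that can be iterated is one about elements killed by a path, and it needs the kernels of
  paths of arbitrary length.\<close>

lemma (in abelian_monoid) finsum_Sigma:
  assumes "finite A" and "\<And>a. a \<in> A \<Longrightarrow> finite (B a)"
    and f: "\<And>a b. a \<in> A \<Longrightarrow> b \<in> B a \<Longrightarrow> f a b \<in> carrier G"
  shows "(\<Oplus>a\<in>A. \<Oplus>b\<in>B a. f a b) = finsum G (\<lambda>(a, b). f a b) (Sigma A B)"
proof -
  have "finsum G (\<lambda>(a, b). f a b) (Sigma A B) = finsum G (\<lambda>(a, b). f a b) (\<Union>a\<in>A. Pair a ` B a)"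
    by (rule arg_cong[where f = "finsum G _"]) auto
  also have "\<dots> = (\<Oplus>a\<in>A. finsum G (\<lambda>(a, b). f a b) (Pair a ` B a))"
    by (rule add.finprod_UN_disjoint) (use assms in \<open>auto simp: pairwise_def disjnt_def\<close>)
  also have "\<dots> = (\<Oplus>a\<in>A. \<Oplus>b\<in>B a. f a b)"
  proof (rule finsum_cong')
    fix a assume a: "a \<in> A"
    show "finsum G (\<lambda>(a, b). f a b) (Pair a ` B a) = (\<Oplus>b\<in>B a. f a b)"
      by (subst finsum_reindex) (use f[OF a] in \<open>auto simp: inj_on_def\<close>)
  qed (use f in \<open>auto intro!: finsum_closed\<close>)
  finally show ?thesis by simp
qed

section \<open>Paths of a quiver and their factorizations\<close>

context fin_digraph
begin

lemma mem_paths_iff: "p \<in> paths G \<longleftrightarrow> awalk (fst p) (snd p) (ptgt G p)"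
  by (auto simp: paths_def ptgt_def)

lemma pcomp_paths:
  assumes "p \<in> paths G" "q \<in> paths G" "psrc p = ptgt G q"
  shows "pcomp p q \<in> paths G" "ptgt G (pcomp p q) = ptgt G p" "psrc (pcomp p q) = psrc q"
proof -
  have "awalk (fst q) (snd q @ snd p) (ptgt G p)"
    using assms by (auto simp: mem_paths_iff psrc_def)
  then show "pcomp p q \<in> paths G" "ptgt G (pcomp p q) = ptgt G p"
    by (auto simp: paths_def ptgt_def pcomp_def)
qed (simp add: pcomp_def psrc_def)

lemma trivial_path_in_paths: "v \<in> verts G \<Longrightarrow> (v, []) \<in> paths G"
  by (auto simp: paths_def awalk_simps)

lemma path_ends_in_verts: "p \<in> paths G \<Longrightarrow> psrc p \<in> verts G" "p \<in> paths G \<Longrightarrow> ptgt G p \<in> verts G"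
  by (auto simp: mem_paths_iff psrc_def)

lemma ptgt_trivial [simp]: "ptgt G (v, []) = v"
  by (simp add: ptgt_def)

lemma awalk_imp_path:
  assumes "awalk u xs v"
  shows "(u, xs) \<in> paths G" "ptgt G (u, xs) = v"
  using assms by (auto simp: paths_def ptgt_def)

text \<open>The index set of the sum that defines the coefficient at \<open>r\<close> of a product
  in the path algebra.\<close>

definition factorizations where
  "factorizations r = {(p, q). p \<in> paths G \<and> q \<in> paths G \<and> psrc p = ptgt G q \<and> pcomp p q = r}"

text \<open>A factorization is determined by the place where the list of arrows is cut; the vertex
  at which the second piece starts is recovered as the end of the first.\<close>

lemma finite_factorizations: "finite (factorizations r)"
proof (rule finite_subset)
  show "factorizations r \<subseteq> (\<lambda>i. ((awlast (fst r) (take i (snd r)), drop i (snd r)),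
      (fst r, take i (snd r)))) ` {..length (snd r)}"
  proof
    fix x assume "x \<in> factorizations r"
    then obtain p q where "x = (p, q)" "psrc p = ptgt G q" "r = pcomp p q"
      by (auto simp: factorizations_def)
    then show "x \<in> (\<lambda>i. ((awlast (fst r) (take i (snd r)), drop i (snd r)),
        (fst r, take i (snd r)))) ` {..length (snd r)}"
      by (intro image_eqI[of _ _ "length (snd q)"]) (simp_all add: pcomp_def psrc_def ptgt_def prod_eq_iff)
  qed
qed simp

lemma factorizations_paths:
  "(p, q) \<in> factorizations r \<Longrightarrow> p \<in> paths G \<and> q \<in> paths G \<and> psrc p = ptgt G q \<and> pcomp p q = r \<and> r \<in> paths G"
  by (auto simp: factorizations_def pcomp_paths)

lemma pcomp_assoc: "pcomp (pcomp p q) r = pcomp p (pcomp q r)"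
  by (simp add: pcomp_def)

text \<open>Both sides describe the factorizations of \<open>r\<close> into three paths
  \<open>a b c\<close>, once as \<open>a (b c)\<close> and once as \<open>(a b) c\<close>. This is
  the combinatorial content of associativity in the path algebra.\<close>

lemma bij_betw_factorizations:
  "bij_betw (\<lambda>x. ((pcomp (fst (fst x)) (fst (snd x)), snd (snd x)), (fst (fst x), fst (snd x))))
     (SIGMA x:factorizations r. factorizations (snd x)) (SIGMA x:factorizations r. factorizations (fst x))"
  (is "bij_betw ?f ?S ?T")
proof -
  have iff: "x \<in> factorizations r \<longleftrightarrow> fst x \<in> paths G \<and> snd x \<in> paths G \<and>
      psrc (fst x) = ptgt G (snd x) \<and> pcomp (fst x) (snd x) = r" for x r
    by (simp add: factorizations_def case_prod_unfold)
  have Sigma_iff: "x \<in> Sigma A B \<longleftrightarrow> fst x \<in> A \<and> snd x \<in> B (fst x)" for x A B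
    by (cases x) simp
  let ?g = "\<lambda>x. ((fst (snd x), pcomp (snd (snd x)) (snd (fst x))), (snd (snd x), snd (fst x)))"
  show ?thesis
  proof (rule bij_betw_byWitness[where f' = ?g])
    show "\<forall>x \<in> ?S. ?g (?f x) = x"
      by (rule ballI) (simp add: Sigma_iff iff prod_eq_iff)
    show "\<forall>x \<in> ?T. ?f (?g x) = x"
      by (rule ballI) (simp add: Sigma_iff iff prod_eq_iff)
    have "?f x \<in> ?T" if "x \<in> ?S" for x
      using that pcomp_paths[of "fst (fst x)" "fst (snd x)"] pcomp_paths[of "fst (snd x)" "snd (snd x)"]
      by (simp add: Sigma_iff iff pcomp_assoc)
    then show "?f ` ?S \<subseteq> ?T" by blast
    have "?g x \<in> ?S" if "x \<in> ?T" for x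
      using that pcomp_paths[of "fst (snd x)" "snd (snd x)"] pcomp_paths[of "snd (snd x)" "snd (fst x)"]
      by (simp add: Sigma_iff iff flip: pcomp_assoc)
    then show "?g ` ?T \<subseteq> ?S" by blast
  qed
qed

end

section \<open>The ring structure of the path algebra\<close>

locale path_algebra_context = k?: ring k + fin_digraph Q
  for k :: "('k, 'l) ring_scheme" and Q :: "('v, 'e) pre_digraph"
begin

abbreviation PA where "PA \<equiv> path_algebra k Q"

lemma path_algebra_carrier:
  "f \<in> carrier PA \<longleftrightarrow> (\<forall>p. f p \<in> carrier k) \<and> (\<forall>p. p \<notin> paths Q \<longrightarrow> f p = \<zero>\<^bsub>k\<^esub>) \<and>
    finite {p. f p \<noteq> \<zero>\<^bsub>k\<^esub>}"
  unfolding path_algebra_def by (auto simp: k.zero_closed)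

lemma path_algebra_simps:
  "\<zero>\<^bsub>PA\<^esub> = (\<lambda>r. \<zero>\<^bsub>k\<^esub>)" "f \<oplus>\<^bsub>PA\<^esub> g = (\<lambda>r. f r \<oplus>\<^bsub>k\<^esub> g r)"
  "\<one>\<^bsub>PA\<^esub> = (\<lambda>r. if r \<in> paths Q \<and> plen r = 0 then \<one>\<^bsub>k\<^esub> else \<zero>\<^bsub>k\<^esub>)"
  "f \<otimes>\<^bsub>PA\<^esub> g = (\<lambda>r. finsum k (\<lambda>(p, q). f p \<otimes>\<^bsub>k\<^esub> g q) (factorizations r))"
  unfolding path_algebra_def factorizations_def by simp_all

lemma path_algebra_coeff: "f \<in> carrier PA \<Longrightarrow> f p \<in> carrier k"
  unfolding path_algebra_carrier by blast

lemma path_algebra_outside: "f \<in> carrier PA \<Longrightarrow> p \<notin> paths Q \<Longrightarrow> f p = \<zero>\<^bsub>k\<^esub>"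
  unfolding path_algebra_carrier by blast

text \<open>A sum that is not zero has a term that is not zero. All arguments about supports of
  products rest on this, for closure of the carrier as well as for ideals given by a condition on
  supports.\<close>

lemma path_algebra_mult_support:
  assumes "f \<in> carrier PA" "g \<in> carrier PA" "(f \<otimes>\<^bsub>PA\<^esub> g) r \<noteq> \<zero>\<^bsub>k\<^esub>"
  obtains p q where "(p, q) \<in> factorizations r" "f p \<noteq> \<zero>\<^bsub>k\<^esub>" "g q \<noteq> \<zero>\<^bsub>k\<^esub>"
proof (rule ccontr)
  assume "\<not> thesis"
  then have "(p, q) \<in> factorizations r \<Longrightarrow> f p \<otimes>\<^bsub>k\<^esub> g q = \<zero>\<^bsub>k\<^esub>" for p q
    using that assms(1,2) by (metis k.l_null k.r_null path_algebra_coeff)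
  then have "(f \<otimes>\<^bsub>PA\<^esub> g) r = \<zero>\<^bsub>k\<^esub>"
    by (auto simp: path_algebra_simps intro!: k.add.finprod_one_eqI)
  then show False using assms by simp
qed

lemma path_algebra_mult_closed:
  assumes "f \<in> carrier PA" "g \<in> carrier PA"
  shows "f \<otimes>\<^bsub>PA\<^esub> g \<in> carrier PA"
proof -
  let ?supp = "\<lambda>f. {p. f p \<noteq> \<zero>\<^bsub>k\<^esub>}"
  have "?supp (f \<otimes>\<^bsub>PA\<^esub> g) \<subseteq> (\<lambda>(p, q). pcomp p q) ` (?supp f \<times> ?supp g)"
  proof
    fix r assume "r \<in> ?supp (f \<otimes>\<^bsub>PA\<^esub> g)"
    then obtain p q where "(p, q) \<in> factorizations r" "f p \<noteq> \<zero>\<^bsub>k\<^esub>" "g q \<noteq> \<zero>\<^bsub>k\<^esub>"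
      using path_algebra_mult_support[OF assms] by blast
    then show "r \<in> (\<lambda>(p, q). pcomp p q) ` (?supp f \<times> ?supp g)"
      by (intro image_eqI[of _ _ "(p, q)"]) (auto simp: factorizations_def)
  qed
  moreover have "finite (?supp f)" "finite (?supp g)"
    using assms by (auto simp: path_algebra_carrier)
  ultimately have "finite (?supp (f \<otimes>\<^bsub>PA\<^esub> g))"
    by (meson finite_SigmaI finite_imageI finite_subset)
  moreover have "(f \<otimes>\<^bsub>PA\<^esub> g) r = \<zero>\<^bsub>k\<^esub>" if "r \<notin> paths Q" for r
    using that by (metis factorizations_paths path_algebra_mult_support[OF assms])
  moreover have "(f \<otimes>\<^bsub>PA\<^esub> g) r \<in> carrier k" for r
    using assms by (auto simp: path_algebra_simps path_algebra_coeff intro!: k.finsum_closed)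
  ultimately show ?thesis
    by (simp add: path_algebra_carrier)
qed

lemma path_algebra_abelian_group: "abelian_group PA"
proof (rule abelian_groupI)
  fix f g assume "f \<in> carrier PA" "g \<in> carrier PA"
  moreover have "{p. f p \<oplus>\<^bsub>k\<^esub> g p \<noteq> \<zero>\<^bsub>k\<^esub>} \<subseteq> {p. f p \<noteq> \<zero>\<^bsub>k\<^esub>} \<union> {p. g p \<noteq> \<zero>\<^bsub>k\<^esub>}"
    by auto
  ultimately show "f \<oplus>\<^bsub>PA\<^esub> g \<in> carrier PA"
    by (auto simp: path_algebra_carrier path_algebra_simps intro: finite_subset)
next
  fix f assume f: "f \<in> carrier PA"
  have "(\<lambda>r. \<ominus>\<^bsub>k\<^esub> f r) \<in> carrier PA"
  proof -
    have "{p. \<ominus>\<^bsub>k\<^esub> f p \<noteq> \<zero>\<^bsub>k\<^esub>} \<subseteq> {p. f p \<noteq> \<zero>\<^bsub>k\<^esub>}" by auto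
    with f show ?thesis
      by (auto simp: path_algebra_carrier intro: finite_subset)
  qed
  then show "\<exists>g \<in> carrier PA. g \<oplus>\<^bsub>PA\<^esub> f = \<zero>\<^bsub>PA\<^esub>"
    using f by (intro bexI) (auto simp: path_algebra_simps path_algebra_coeff k.l_neg)
next
  fix f g h assume "f \<in> carrier PA" "g \<in> carrier PA" "h \<in> carrier PA"
  note [simp] = this[THEN path_algebra_coeff]
  show "f \<oplus>\<^bsub>PA\<^esub> g \<oplus>\<^bsub>PA\<^esub> h = f \<oplus>\<^bsub>PA\<^esub> (g \<oplus>\<^bsub>PA\<^esub> h)"
    by (simp add: path_algebra_simps k.a_assoc)
next
  fix f g assume "f \<in> carrier PA" "g \<in> carrier PA"
  note [simp] = this[THEN path_algebra_coeff]
  show "f \<oplus>\<^bsub>PA\<^esub> g = g \<oplus>\<^bsub>PA\<^esub> f"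
    by (simp add: path_algebra_simps k.a_comm)
  show "\<zero>\<^bsub>PA\<^esub> \<oplus>\<^bsub>PA\<^esub> f = f"
    by (simp add: path_algebra_simps)
qed (simp add: path_algebra_simps path_algebra_carrier)

text \<open>After distributing, both bracketings become a sum over the factorizations of
  \<open>r\<close> into three paths, and \<open>bij_betw_factorizations\<close> matches the two
  index sets.\<close>

lemma path_algebra_mult_assoc:
  assumes "f \<in> carrier PA" "g \<in> carrier PA" "h \<in> carrier PA"
  shows "f \<otimes>\<^bsub>PA\<^esub> g \<otimes>\<^bsub>PA\<^esub> h = f \<otimes>\<^bsub>PA\<^esub> (g \<otimes>\<^bsub>PA\<^esub> h)"
proof
  fix r
  note [simp] = path_algebra_coeff[OF assms(1)] path_algebra_coeff[OF assms(2)]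
    path_algebra_coeff[OF assms(3)] finite_factorizations
  have "(f \<otimes>\<^bsub>PA\<^esub> g \<otimes>\<^bsub>PA\<^esub> h) r =
      finsum k (\<lambda>(a, c). finsum k (\<lambda>(p, q). f p \<otimes>\<^bsub>k\<^esub> g q) (factorizations a) \<otimes>\<^bsub>k\<^esub> h c)
        (factorizations r)"
    by (simp add: path_algebra_simps)
  also have "\<dots> = (\<Oplus>\<^bsub>k\<^esub>x\<in>factorizations r. \<Oplus>\<^bsub>k\<^esub>y\<in>factorizations (fst x).
      f (fst y) \<otimes>\<^bsub>k\<^esub> g (snd y) \<otimes>\<^bsub>k\<^esub> h (snd x))"
    by (intro k.finsum_cong')
      (auto simp: k.finsum_ldistr split_beta intro!: k.finsum_closed)
  also have "\<dots> = finsum k (\<lambda>(x, y). f (fst y) \<otimes>\<^bsub>k\<^esub> g (snd y) \<otimes>\<^bsub>k\<^esub> h (snd x))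
      (SIGMA x:factorizations r. factorizations (fst x))"
    by (subst k.finsum_Sigma) (auto simp: split_beta)
  also have "\<dots> = finsum k (\<lambda>(x, y). f (fst x) \<otimes>\<^bsub>k\<^esub> (g (fst y) \<otimes>\<^bsub>k\<^esub> h (snd y)))
      (SIGMA x:factorizations r. factorizations (snd x))"
    by (subst bij_betw_imp_surj_on[OF bij_betw_factorizations, symmetric], subst k.finsum_reindex)
      (auto simp: case_prod_unfold k.m_assoc bij_betw_imp_inj_on[OF bij_betw_factorizations])
  also have "\<dots> = (\<Oplus>\<^bsub>k\<^esub>x\<in>factorizations r. \<Oplus>\<^bsub>k\<^esub>y\<in>factorizations (snd x).
      f (fst x) \<otimes>\<^bsub>k\<^esub> (g (fst y) \<otimes>\<^bsub>k\<^esub> h (snd y)))"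
    by (subst k.finsum_Sigma) auto
  also have "\<dots> = finsum k (\<lambda>(p, b). f p \<otimes>\<^bsub>k\<^esub> finsum k (\<lambda>(q, c). g q \<otimes>\<^bsub>k\<^esub> h c) (factorizations b))
      (factorizations r)"
    by (intro k.finsum_cong')
      (auto simp: k.finsum_rdistr split_beta intro!: k.finsum_closed)
  also have "\<dots> = (f \<otimes>\<^bsub>PA\<^esub> (g \<otimes>\<^bsub>PA\<^esub> h)) r"
    by (simp add: path_algebra_simps)
  finally show "(f \<otimes>\<^bsub>PA\<^esub> g \<otimes>\<^bsub>PA\<^esub> h) r = (f \<otimes>\<^bsub>PA\<^esub> (g \<otimes>\<^bsub>PA\<^esub> h)) r" .
qed

text \<open>The identity is the sum of the trivial paths, so its support is finite because the
  quiver has finitely many vertices.\<close>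

lemma path_algebra_one_closed: "\<one>\<^bsub>PA\<^esub> \<in> carrier PA"
proof -
  have "{r \<in> paths Q. plen r = 0} \<subseteq> (\<lambda>v. (v, [])) ` verts Q"
    by (auto simp: paths_def plen_def)
  then have "finite {r \<in> paths Q. plen r = 0}"
    by (rule finite_subset) simp
  moreover have "{p. \<one>\<^bsub>PA\<^esub> p \<noteq> \<zero>\<^bsub>k\<^esub>} \<subseteq> {r \<in> paths Q. plen r = 0}"
    by (auto simp: path_algebra_simps split: if_splits)
  ultimately have "finite {p. \<one>\<^bsub>PA\<^esub> p \<noteq> \<zero>\<^bsub>k\<^esub>}"
    by (rule rev_finite_subset)
  then show ?thesis
    unfolding path_algebra_carrier by (simp add: path_algebra_simps)
qed

text \<open>For products in which a single factorization contributes: those with the identity and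
  those of two paths.\<close>

lemma path_algebra_mult_eqI:
  assumes fact: "(p, q) \<in> factorizations r" and f: "f \<in> carrier PA" and g: "g \<in> carrier PA"
    and zero: "\<And>p' q'. (p', q') \<in> factorizations r \<Longrightarrow> (p', q') \<noteq> (p, q) \<Longrightarrow> f p' = \<zero>\<^bsub>k\<^esub> \<or> g q' = \<zero>\<^bsub>k\<^esub>"
  shows "(f \<otimes>\<^bsub>PA\<^esub> g) r = f p \<otimes>\<^bsub>k\<^esub> g q"
proof -
  note [simp] = path_algebra_coeff[OF f] path_algebra_coeff[OF g]
  have "f p' \<otimes>\<^bsub>k\<^esub> g q' = \<zero>\<^bsub>k\<^esub>" if "(p', q') \<in> factorizations r" "(p, q) \<noteq> (p', q')" for p' q'
    using zero[OF that(1)] that(2) by auto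
  from this[of "fst x" "snd x" for x]
  have "(case x of (p', q') \<Rightarrow> f p' \<otimes>\<^bsub>k\<^esub> g q') =
      (if (p, q) = x then f (fst x) \<otimes>\<^bsub>k\<^esub> g (snd x) else \<zero>\<^bsub>k\<^esub>)" if "x \<in> factorizations r" for x
    using that by (simp add: case_prod_unfold)
  then have "(f \<otimes>\<^bsub>PA\<^esub> g) r =
      (\<Oplus>\<^bsub>k\<^esub>x\<in>factorizations r. if (p, q) = x then f (fst x) \<otimes>\<^bsub>k\<^esub> g (snd x) else \<zero>\<^bsub>k\<^esub>)"
    unfolding path_algebra_simps(4) by (intro k.finsum_cong') auto
  also have "\<dots> = f p \<otimes>\<^bsub>k\<^esub> g q"
    by (subst k.finsum_singleton) (use fact finite_factorizations in auto)
  finally show ?thesis .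
qed

text \<open>\<open>Idl\<close> is an intersection over all ideals, and being an ideal includes the
  ring axioms for the ambient structure. So the ring axioms have to come before any statement about
  membership in \<open>I\<close>.\<close>

lemma path_algebra_ring: "ring PA"
proof (rule ringI)
  show "monoid PA"
  proof (rule monoidI)
    fix f assume f: "f \<in> carrier PA"
    note [simp] = path_algebra_coeff[OF f]
    show "\<one>\<^bsub>PA\<^esub> \<otimes>\<^bsub>PA\<^esub> f = f"
    proof
      fix r
      show "(\<one>\<^bsub>PA\<^esub> \<otimes>\<^bsub>PA\<^esub> f) r = f r"
      proof (cases "r \<in> paths Q")
        case True
        have "((ptgt Q r, []), r) \<in> factorizations r"
          using True by (auto simp: factorizations_def psrc_def pcomp_def
              intro: trivial_path_in_paths path_ends_in_verts)
        moreover have "\<one>\<^bsub>PA\<^esub> p = \<zero>\<^bsub>k\<^esub>"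
          if "(p, q) \<in> factorizations r" "(p, q) \<noteq> ((ptgt Q r, []), r)" for p q
        proof -
          have "psrc p = ptgt Q q" "pcomp p q = r"
            using that by (auto simp: factorizations_def)
          \<comment> \<open>If \<open>p\<close> had no arrows, then \<open>q = r\<close>, and
            \<open>p\<close> would be the trivial path at the end of \<open>r\<close>, which is the
            excluded pair.\<close>
          with that(2) have "snd p \<noteq> []"
            by (cases p; cases q) (auto simp: psrc_def pcomp_def)
          then show ?thesis
            by (simp add: path_algebra_simps plen_def)
        qed
        ultimately have "(\<one>\<^bsub>PA\<^esub> \<otimes>\<^bsub>PA\<^esub> f) r = \<one>\<^bsub>PA\<^esub> (ptgt Q r, []) \<otimes>\<^bsub>k\<^esub> f r"
          by (intro path_algebra_mult_eqI path_algebra_one_closed f) auto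
        with True show ?thesis
          by (simp add: path_algebra_simps(3) plen_def trivial_path_in_paths path_ends_in_verts)
      next
        case False
        then show ?thesis
          using path_algebra_outside[OF f]
            path_algebra_outside[OF path_algebra_mult_closed[OF path_algebra_one_closed f]] by simp
      qed
    qed
    show "f \<otimes>\<^bsub>PA\<^esub> \<one>\<^bsub>PA\<^esub> = f"
    proof
      fix r
      show "(f \<otimes>\<^bsub>PA\<^esub> \<one>\<^bsub>PA\<^esub>) r = f r"
      proof (cases "r \<in> paths Q")
        case True
        have "(r, (psrc r, [])) \<in> factorizations r"
          using True by (auto simp: factorizations_def pcomp_def psrc_def
              intro: trivial_path_in_paths path_ends_in_verts[unfolded psrc_def])
        moreover have "\<one>\<^bsub>PA\<^esub> q = \<zero>\<^bsub>k\<^esub>"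
          if "(p, q) \<in> factorizations r" "(p, q) \<noteq> (r, (psrc r, []))" for p q
        proof -
          have "psrc p = ptgt Q q" "pcomp p q = r"
            using that by (auto simp: factorizations_def)
          with that(2) have "snd q \<noteq> []"
            by (cases p; cases q) (auto simp: psrc_def pcomp_def)
          then show ?thesis
            by (simp add: path_algebra_simps plen_def)
        qed
        ultimately have "(f \<otimes>\<^bsub>PA\<^esub> \<one>\<^bsub>PA\<^esub>) r = f r \<otimes>\<^bsub>k\<^esub> \<one>\<^bsub>PA\<^esub> (psrc r, [])"
          by (intro path_algebra_mult_eqI path_algebra_one_closed f) auto
        with True show ?thesis
          by (simp add: path_algebra_simps(3) plen_def trivial_path_in_paths path_ends_in_verts)
      next
        case False
        then show ?thesis
          using path_algebra_outside[OF f]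
            path_algebra_outside[OF path_algebra_mult_closed[OF f path_algebra_one_closed]] by simp
      qed
    qed
  qed (simp_all add: path_algebra_mult_closed path_algebra_one_closed path_algebra_mult_assoc)
next
  fix f g h assume "f \<in> carrier PA" "g \<in> carrier PA" "h \<in> carrier PA"
  note [simp] = this[THEN path_algebra_coeff]
  show "(f \<oplus>\<^bsub>PA\<^esub> g) \<otimes>\<^bsub>PA\<^esub> h = f \<otimes>\<^bsub>PA\<^esub> h \<oplus>\<^bsub>PA\<^esub> g \<otimes>\<^bsub>PA\<^esub> h"
    by (auto simp: path_algebra_simps case_prod_unfold k.l_distr Pi_def simp flip: k.finsum_addf)
  show "h \<otimes>\<^bsub>PA\<^esub> (f \<oplus>\<^bsub>PA\<^esub> g) = h \<otimes>\<^bsub>PA\<^esub> f \<oplus>\<^bsub>PA\<^esub> h \<otimes>\<^bsub>PA\<^esub> g"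
    by (auto simp: path_algebra_simps case_prod_unfold k.r_distr Pi_def simp flip: k.finsum_addf)
qed (rule path_algebra_abelian_group)

section \<open>Paths in the ideal generated by a set of paths\<close>

lemma path_elt_closed: "p \<in> paths Q \<Longrightarrow> path_elt k p \<in> carrier PA"
  by (auto simp: path_algebra_carrier path_elt_def)

lemma path_elt_mult:
  assumes "p \<in> paths Q" "q \<in> paths Q" "psrc p = ptgt Q q"
  shows "path_elt k p \<otimes>\<^bsub>PA\<^esub> path_elt k q = path_elt k (pcomp p q)"
proof
  fix r
  show "(path_elt k p \<otimes>\<^bsub>PA\<^esub> path_elt k q) r = path_elt k (pcomp p q) r"
  proof (cases "r = pcomp p q")
    case True
    then have "(p, q) \<in> factorizations r"
      using assms by (simp add: factorizations_def)
    then have "(path_elt k p \<otimes>\<^bsub>PA\<^esub> path_elt k q) r = path_elt k p p \<otimes>\<^bsub>k\<^esub> path_elt k q q"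
      by (intro path_algebra_mult_eqI path_elt_closed assms) (auto simp: path_elt_def)
    with True show ?thesis
      by (simp add: path_elt_def)
  next
    case False
    have "(path_elt k p \<otimes>\<^bsub>PA\<^esub> path_elt k q) r = \<zero>\<^bsub>k\<^esub>"
    proof (rule ccontr)
      assume "(path_elt k p \<otimes>\<^bsub>PA\<^esub> path_elt k q) r \<noteq> \<zero>\<^bsub>k\<^esub>"
      from path_algebra_mult_support[OF assms(1,2)[THEN path_elt_closed] this] False show False
        by (metis factorizations_paths path_elt_def)
    qed
    with False show ?thesis
      by (simp add: path_elt_def)
  qed
qed

text \<open>The functions supported on paths with a subpath in \<open>rho\<close> form an ideal.\<close>

lemma path_elt_in_Idl_iff:
  assumes "\<one>\<^bsub>k\<^esub> \<noteq> \<zero>\<^bsub>k\<^esub>" and rho: "rho \<subseteq> {p \<in> paths Q. snd p \<noteq> []}" and p: "p \<in> paths Q"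
  shows "path_elt k p \<in> Idl\<^bsub>PA\<^esub> (path_elt k ` rho) \<longleftrightarrow> (\<exists>m \<in> rho. sublist (snd m) (snd p))"
proof -
  interpret PA: ring PA by (rule path_algebra_ring)
  show ?thesis
  proof
    define J where "J = {f \<in> carrier PA. \<forall>r. f r \<noteq> \<zero>\<^bsub>k\<^esub> \<longrightarrow> (\<exists>m \<in> rho. sublist (snd m) (snd r))}"
    have "subgroup J (add_monoid PA)"
    proof (rule PA.add.subgroupI)
      show "J \<subseteq> carrier PA" by (auto simp: J_def)
      have "\<zero>\<^bsub>PA\<^esub> \<in> J"
        using PA.zero_closed by (auto simp: J_def path_algebra_simps)
      then show "J \<noteq> {}" by auto
      fix f assume f: "f \<in> J"
      have fc: "f \<in> carrier PA" using f by (simp add: J_def)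
      have "(\<ominus>\<^bsub>PA\<^esub> f) r = \<zero>\<^bsub>k\<^esub>" if "f r = \<zero>\<^bsub>k\<^esub>" for r
        using fun_cong[OF PA.l_neg[OF fc], of r] that
          path_algebra_coeff[OF PA.a_inv_closed[OF fc], of r]
        by (simp add: path_algebra_simps)
      then show "\<ominus>\<^bsub>PA\<^esub> f \<in> J"
        using f PA.a_inv_closed[OF fc] unfolding J_def by blast
      fix g assume "g \<in> J"
      then show "f \<oplus>\<^bsub>PA\<^esub> g \<in> J"
        using f PA.add.m_closed[of f g] unfolding J_def path_algebra_simps
        by (auto, metis k.l_zero k.zero_closed)
    qed
    then have "ideal J PA"
    proof (rule idealI[OF path_algebra_ring])
      fix f g assume f: "f \<in> J" and g: "g \<in> carrier PA"
      then have fc: "f \<in> carrier PA" by (simp add: J_def)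
      have sub: "\<exists>m\<in>rho. sublist (snd m) (snd (pcomp p q))" if nz: "f p \<noteq> \<zero>\<^bsub>k\<^esub> \<or> f q \<noteq> \<zero>\<^bsub>k\<^esub>" for p q
      proof -
        obtain m where "m \<in> rho" "sublist (snd m) (snd p) \<or> sublist (snd m) (snd q)"
          using nz f unfolding J_def by blast
        then show ?thesis
          by (auto simp: pcomp_def sublist_append)
      qed
      have "\<exists>m\<in>rho. sublist (snd m) (snd r)" if "(g \<otimes>\<^bsub>PA\<^esub> f) r \<noteq> \<zero>\<^bsub>k\<^esub>" for r
        by (rule path_algebra_mult_support[OF g fc that]) (metis factorizations_paths sub)
      then show "g \<otimes>\<^bsub>PA\<^esub> f \<in> J"
        using path_algebra_mult_closed[OF g fc] unfolding J_def by blast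
      have "\<exists>m\<in>rho. sublist (snd m) (snd r)" if "(f \<otimes>\<^bsub>PA\<^esub> g) r \<noteq> \<zero>\<^bsub>k\<^esub>" for r
        by (rule path_algebra_mult_support[OF fc g that]) (metis factorizations_paths sub)
      then show "f \<otimes>\<^bsub>PA\<^esub> g \<in> J"
        using path_algebra_mult_closed[OF fc g] unfolding J_def by blast
    qed
    moreover have "path_elt k ` rho \<subseteq> J"
      using rho by (auto simp: J_def path_elt_closed) (force simp: path_elt_def split: if_splits)
    ultimately have "Idl\<^bsub>PA\<^esub> (path_elt k ` rho) \<subseteq> J"
      by (auto simp: genideal_def)
    moreover assume "path_elt k p \<in> Idl\<^bsub>PA\<^esub> (path_elt k ` rho)"
    moreover have "path_elt k p p \<noteq> \<zero>\<^bsub>k\<^esub>"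
      using assms(1) by (simp add: path_elt_def)
    ultimately show "\<exists>m \<in> rho. sublist (snd m) (snd p)"
      unfolding J_def by blast
  next
    assume "\<exists>m \<in> rho. sublist (snd m) (snd p)"
    then obtain m xs ys where m: "m \<in> rho" and eq: "snd p = xs @ snd m @ ys"
      by (auto simp: sublist_def)
    obtain u ms where m_eq: "m = (u, ms)" by fastforce
    have mp: "m \<in> paths Q" and "ms \<noteq> []" using m rho m_eq by auto
    have "awalk (fst p) (xs @ ms @ ys) (ptgt Q p)"
      using p eq m_eq by (simp add: mem_paths_iff)
    then obtain v w where w: "awalk (fst p) xs v" "awalk v ms w" "awalk w ys (ptgt Q p)"
      by auto
    \<comment> \<open>\<open>sublist\<close> compares arrows only. A nonempty list of arrows
      determines the vertex at which it starts, so the walk inside \<open>p\<close> is the path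
      \<open>m\<close> itself. For a trivial \<open>m\<close> this would fail.\<close>
    have "awalk u ms (ptgt Q m)" using mp m_eq by (simp add: mem_paths_iff)
    with w(2) \<open>ms \<noteq> []\<close> have "u = v"
      by (cases ms) (simp_all add: awalk_Cons_iff)
    moreover from this have "ptgt Q m = w"
      using awalk_imp_path(2)[OF w(2)] by (simp add: m_eq)
    ultimately have "path_elt k m \<otimes>\<^bsub>PA\<^esub> path_elt k (fst p, xs) = path_elt k (fst p, xs @ ms)"
      using awalk_imp_path[OF w(1)] mp m_eq by (simp add: path_elt_mult psrc_def pcomp_def)
    moreover have xms: "awalk (fst p) (xs @ ms) w"
      using w by auto
    moreover have "pcomp (w, ys) (fst p, xs @ ms) = p"
      using eq m_eq by (simp add: pcomp_def prod_eq_iff)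
    ultimately have p_eq: "path_elt k p =
        path_elt k (w, ys) \<otimes>\<^bsub>PA\<^esub> (path_elt k m \<otimes>\<^bsub>PA\<^esub> path_elt k (fst p, xs))"
      using path_elt_mult[of "(w, ys)" "(fst p, xs @ ms)"] awalk_imp_path[OF xms] awalk_imp_path[OF w(3)]
      by (simp add: psrc_def)
    interpret Idl: ideal "Idl\<^bsub>PA\<^esub> (path_elt k ` rho)" PA
      using rho by (intro PA.genideal_ideal) (auto simp: path_elt_closed)
    have "path_elt k m \<in> Idl\<^bsub>PA\<^esub> (path_elt k ` rho)"
    proof -
      have "path_elt k ` rho \<subseteq> carrier PA"
        using rho by (auto simp: path_elt_closed)
      from PA.genideal_self[OF this] m show ?thesis by blast
    qed
    then show "path_elt k p \<in> Idl\<^bsub>PA\<^esub> (path_elt k ` rho)"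
      unfolding p_eq using w by (intro Idl.I_l_closed Idl.I_r_closed path_elt_closed awalk_imp_path)
  qed
qed

end

section \<open>Sums of submodules\<close>

lemma (in abelian_group) a_inv_zero: "\<ominus> \<zero> = \<zero>"
  using r_neg[of \<zero>] by simp

lemma (in abelian_group) additive_subgroup_subset_closed:
  assumes "H \<subseteq> carrier G" "\<zero> \<in> H" "\<And>x y. x \<in> H \<Longrightarrow> y \<in> H \<Longrightarrow> x \<oplus> y \<in> H"
    and "\<And>x. x \<in> H \<Longrightarrow> \<ominus> x \<in> H"
  shows "additive_subgroup H G"
  by (intro additive_subgroupI add.subgroupI) (use assms in auto)

text \<open>For infinite \<open>F\<close> both sums have the default value zero, which
  \<open>h\<close> preserves.\<close>

lemma (in abelian_group_hom) hom_finsum: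
  "f \<in> F \<rightarrow> carrier G \<Longrightarrow> h (\<Oplus>i\<in>F. f i) = (\<Oplus>\<^bsub>H\<^esub>i\<in>F. h (f i))"
  by (induction F rule: infinite_finite_induct) (auto simp: Pi_def)

lemma (in abelian_group_hom) additive_subgroup_image:
  assumes "additive_subgroup S G"
  shows "additive_subgroup (h ` S) H"
proof -
  interpret S: additive_subgroup S G by fact
  show ?thesis
  proof (rule H.additive_subgroup_subset_closed)
    show "h ` S \<subseteq> carrier H" by auto
    show "\<zero>\<^bsub>H\<^esub> \<in> h ` S"
      by (rule image_eqI[of _ _ \<zero>]) auto
    fix x assume "x \<in> h ` S"
    then obtain a where a: "x = h a" "a \<in> S" by blast
    with S.a_inv_closed show "\<ominus>\<^bsub>H\<^esub> x \<in> h ` S"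
      by (intro image_eqI[of _ _ "\<ominus> a"]) auto
    fix y assume "y \<in> h ` S"
    then obtain b where "y = h b" "b \<in> S" by blast
    with a show "x \<oplus>\<^bsub>H\<^esub> y \<in> h ` S"
      by (intro image_eqI[of _ _ "a \<oplus> b"]) auto
  qed
qed

lemma (in abelian_group_hom) inj_on_if_trivial_a_kernel:
  "a_kernel G H h = {\<zero>} \<Longrightarrow> inj_on h (carrier G)"
  using group_hom.trivial_ker_imp_inj[OF a_group_hom] by (simp add: a_kernel_def)

section \<open>Indexed sums of subgroups and their directness\<close>

context
  fixes M :: "('a, 'x, 'm) module_scheme" (structure)
  assumes abelian_group: "abelian_group M"
begin

interpretation M: abelian_group M by (rule abelian_group)

lemma zero_in_submodule_sum: "\<zero> \<in> submodule_sum M K N"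
  unfolding submodule_sum_def by (intro CollectI exI[of _ "{}"] exI[of _ "\<lambda>_. \<zero>"]) auto

lemma submodule_sum_empty: "submodule_sum M {} N = {\<zero>}"
  by (auto simp: submodule_sum_def)

text \<open>Asking of \<open>H\<close> only that it contains zero and is closed under addition makes
  this applicable to sets that are not yet known to be subgroups, as in the proof that the sum is
  closed under negation.\<close>

lemma submodule_sum_least:
  assumes "H \<subseteq> carrier M" "\<zero> \<in> H" and closed: "\<And>x y. x \<in> H \<Longrightarrow> y \<in> H \<Longrightarrow> x \<oplus> y \<in> H"
    and N: "\<And>q. q \<in> K \<Longrightarrow> N q \<subseteq> H"
  shows "submodule_sum M K N \<subseteq> H"
proof -
  have "finsum M x F \<in> H" if "finite F" "F \<subseteq> K" "x \<in> Pi F N" for F x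
    using that
  proof (induction F)
    case empty
    then show ?case using assms by simp
  next
    case (insert q F)
    then have *: "x q \<in> H" "x \<in> F \<rightarrow> H"
      using N by blast+
    with insert(1,2) assms(1) have "finsum M x (insert q F) = x q \<oplus> finsum M x F"
      by (intro M.finsum_insert) auto
    with insert * show ?case
      by (simp add: closed)
  qed
  then show ?thesis
    by (auto simp: submodule_sum_def)
qed

lemma submodule_sum_upper:
  assumes "q \<in> K" "N q \<subseteq> carrier M"
  shows "N q \<subseteq> submodule_sum M K N"
proof
  fix x assume "x \<in> N q"
  then have "finsum M (\<lambda>_. x) {q} = x" "(\<lambda>_. x) \<in> Pi {q} N"
    using assms by auto
  then show "x \<in> submodule_sum M K N"
    unfolding submodule_sum_def using assms(1)
    by (intro CollectI exI[of _ "{q}"] exI[of _ "\<lambda>_. x"]) auto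
qed

lemma submodule_sum_mono:
  assumes "\<And>q. q \<in> K \<Longrightarrow> N q \<subseteq> N' q"
  shows "submodule_sum M K N \<subseteq> submodule_sum M K N'"
  using assms unfolding submodule_sum_def by blast

text \<open>Elements of a sum come with finite index sets of their own. Padding with zeros brings
  two of them to a common one.\<close>

lemma finsum_extend_zero:
  assumes "finite F'" "F \<subseteq> F'" "x \<in> F \<rightarrow> carrier M"
  shows "(\<Oplus>q\<in>F'. if q \<in> F then x q else \<zero>) = finsum M x F"
proof (rule sym, rule M.add.finprod_mono_neutral_cong_left)
qed (use assms in auto)

lemma submodule_sum_additive_subgroup:
  assumes N: "\<And>q. q \<in> K \<Longrightarrow> additive_subgroup (N q) M"
  shows "additive_subgroup (submodule_sum M K N) M"
proof (rule M.additive_subgroup_subset_closed)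
  let ?S = "submodule_sum M K N"
  have carr: "N q \<subseteq> carrier M" "\<zero> \<in> N q" if "q \<in> K" for q
    using N[OF that] by (simp_all add: additive_subgroup.a_subset additive_subgroup.zero_closed)
  show sub: "?S \<subseteq> carrier M"
    by (rule submodule_sum_least) (use carr in auto)
  show "\<zero> \<in> ?S" by (rule zero_in_submodule_sum)
  show add: "a \<oplus> b \<in> ?S" if ab: "a \<in> ?S" "b \<in> ?S" for a b
  proof -
    obtain F x F' y where F: "finite F" "F \<subseteq> K" "x \<in> Pi F N" "a = finsum M x F"
      and F': "finite F'" "F' \<subseteq> K" "y \<in> Pi F' N" "b = finsum M y F'"
      using ab by (auto simp: submodule_sum_def)
    define x' where "x' = (\<lambda>q. if q \<in> F then x q else \<zero>)"
    define y' where "y' = (\<lambda>q. if q \<in> F' then y q else \<zero>)"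
    have xy: "x' q \<in> N q" "y' q \<in> N q" if "q \<in> F \<union> F'" for q
      using that F F' carr by (auto simp: x'_def y'_def)
    have "x \<in> F \<rightarrow> carrier M" "y \<in> F' \<rightarrow> carrier M"
      using F F' carr by blast+
    then have "a = finsum M x' (F \<union> F')" "b = finsum M y' (F \<union> F')"
      using F F' unfolding x'_def y'_def by (simp_all add: finsum_extend_zero)
    moreover have "x' \<in> F \<union> F' \<rightarrow> carrier M" "y' \<in> F \<union> F' \<rightarrow> carrier M"
      using xy F(2) F'(2) carr by blast+
    ultimately have "a \<oplus> b = (\<Oplus>q\<in>F \<union> F'. x' q \<oplus> y' q)"
      by (simp add: M.finsum_addf)
    moreover have "x' q \<oplus> y' q \<in> N q" if "q \<in> F \<union> F'" for q
      using additive_subgroup.a_closed[OF N xy(1,2)[OF that]] that F(2) F'(2) by blast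
    ultimately show ?thesis
      unfolding submodule_sum_def using F(1,2) F'(1,2)
      by (intro CollectI exI[of _ "F \<union> F'"] exI[of _ "\<lambda>q. x' q \<oplus> y' q"]) simp
  qed
  \<comment> \<open>Closure under negation by minimality: the elements whose negative lies in the
    sum include every \<open>N q\<close> and are closed under addition.\<close>
  have "?S \<subseteq> {a \<in> carrier M. \<ominus> a \<in> ?S}"
  proof (rule submodule_sum_least)
    show "N q \<subseteq> {a \<in> carrier M. \<ominus> a \<in> ?S}" if "q \<in> K" for q
      using that carr submodule_sum_upper[OF that] additive_subgroup.a_inv_closed[OF N[OF that]]
      by blast
  qed (use zero_in_submodule_sum in \<open>auto simp: M.minus_add M.a_inv_zero add\<close>)
  then show "\<ominus> a \<in> ?S" if "a \<in> ?S" for a using that by blast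
qed

lemma direct_family_mono:
  assumes "direct_family M K N" "K' \<subseteq> K" "\<And>q. q \<in> K' \<Longrightarrow> N' q \<subseteq> N q"
  shows "direct_family M K' N'"
proof -
  have "x \<in> Pi F N" if "F \<subseteq> K'" "x \<in> Pi F N'" for F x
    using that assms(3) by blast
  then show ?thesis
    using assms(1,2) unfolding direct_family_def by (meson order_trans)
qed

text \<open>Since each \<open>N q\<close> is a subgroup, the difference of the two families is again
  a family in \<open>N\<close>; its sum is zero, and directness applies to it.\<close>

lemma direct_family_unique:
  assumes dir: "direct_family M K N" and N: "\<And>q. q \<in> K \<Longrightarrow> additive_subgroup (N q) M"
    and F: "finite F" "F \<subseteq> K" and x: "x \<in> Pi F N" and y: "y \<in> Pi F N"
    and eq: "finsum M x F = finsum M y F" and q: "q \<in> F"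
  shows "x q = y q"
proof -
  have Nq: "additive_subgroup (N r) M" if "r \<in> F" for r
    using that F N by blast
  have xc: "x \<in> F \<rightarrow> carrier M" and yc: "y \<in> F \<rightarrow> carrier M"
    using x y additive_subgroup.a_subset[OF Nq] by blast+
  from F(1) yc have "(\<Oplus>r\<in>F. \<ominus> y r) = \<ominus> finsum M y F"
    by (induction F) (auto simp: M.minus_add M.a_inv_zero Pi_def)
  then have "(\<Oplus>r\<in>F. x r \<oplus> \<ominus> y r) = finsum M x F \<oplus> \<ominus> finsum M y F"
    using xc yc by (subst M.finsum_addf) auto
  also have "\<dots> = \<zero>"
    unfolding eq using yc by (auto intro!: M.r_neg)
  finally have "(\<Oplus>r\<in>F. x r \<oplus> \<ominus> y r) = \<zero>" .
  moreover have "x r \<oplus> \<ominus> y r \<in> N r" if "r \<in> F" for r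
  proof -
    interpret additive_subgroup "N r" M by (rule Nq[OF that])
    show ?thesis using that x y by auto
  qed
  ultimately have "x q \<oplus> \<ominus> y q = \<zero>"
    using dir[unfolded direct_family_def, rule_format, of F "\<lambda>r. x r \<oplus> \<ominus> y r" q] F q by simp
  then show ?thesis
    using xc yc q M.minus_equality[of "x q" "\<ominus> y q"] by (simp add: Pi_def)
qed

text \<open>A common element has one expansion supported in \<open>K\<close> and another supported
  in \<open>L\<close>. They agree by uniqueness, so all components are zero.\<close>

lemma direct_family_Int:
  assumes dir: "direct_family M (K \<union> L) N" and N: "\<And>q. q \<in> K \<union> L \<Longrightarrow> additive_subgroup (N q) M"
    and "K \<inter> L = {}"
  shows "submodule_sum M K N \<inter> submodule_sum M L N = {\<zero>}"
proof -
  have "a = \<zero>" if ab: "a \<in> submodule_sum M K N" "a \<in> submodule_sum M L N" for a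
  proof -
    obtain F x F' y where F: "finite F" "F \<subseteq> K" "x \<in> Pi F N" "a = finsum M x F"
      and F': "finite F'" "F' \<subseteq> L" "y \<in> Pi F' N" "a = finsum M y F'"
      using ab by (auto simp: submodule_sum_def)
    define x' where "x' = (\<lambda>q. if q \<in> F then x q else \<zero>)"
    define y' where "y' = (\<lambda>q. if q \<in> F' then y q else \<zero>)"
    have Nc: "N q \<subseteq> carrier M" "\<zero> \<in> N q" if "q \<in> K \<union> L" for q
      using N[OF that] by (simp_all add: additive_subgroup.a_subset additive_subgroup.zero_closed)
    have "x \<in> F \<rightarrow> carrier M" "y \<in> F' \<rightarrow> carrier M"
      using F F' Nc by blast+
    then have sums: "finsum M x' (F \<union> F') = a" "finsum M y' (F \<union> F') = a"
      using F F' unfolding x'_def y'_def by (simp_all add: finsum_extend_zero)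
    have "x' q \<in> N q" "y' q \<in> N q" if "q \<in> F \<union> F'" for q
      using that F F' Nc(2)[of q] by (auto simp: x'_def y'_def)
    then have Pi: "x' \<in> Pi (F \<union> F') N" "y' \<in> Pi (F \<union> F') N"
      by simp_all
    have eq: "x' q = y' q" if "q \<in> F \<union> F'" for q
      by (rule direct_family_unique[OF dir N _ _ Pi _ that]) (use F F' sums in auto)
    have "x' q = \<zero>" if "q \<in> F \<union> F'" for q
      using eq[OF that] F(2) F'(2) \<open>K \<inter> L = {}\<close> that unfolding x'_def y'_def by (cases "q \<in> F"; cases "q \<in> F'") auto
    then have "finsum M x' (F \<union> F') = \<zero>"
      by (rule M.add.finprod_one_eqI)
    with sums show ?thesis by simp
  qed
  then show ?thesis
    using zero_in_submodule_sum by blast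
qed

end

section \<open>Monic representations\<close>

locale monic_quiver_rep =
  fixes k :: "('k, 'l) ring_scheme"
    and A :: "('k, 'a, 'm) module_scheme"
    and Q :: "('v, 'e) pre_digraph"
    and I :: "(('v, 'e) qpath \<Rightarrow> 'k) set"
    and rho :: "('v, 'e) qpath set"
    and X :: "('v, 'e, 'a, 'x) quiver_rep"
  assumes fd_algebra: "fd_algebra k A"
    and acyclic: "acyclic_quiver Q"
    and monomial_ideal: "monomial_ideal k Q I rho"
    and representation: "quiver_representation A Q rho X"
    and monic: "monic_rep k Q I X"
begin

interpretation field_k: field k
  using fd_algebra by (rule fd_algebra.axioms)

sublocale fin_digraph Q
  using acyclic by (simp add: acyclic_quiver_def)

interpretation path_algebra_context k Q ..

text \<open>Stated for lists of arrows, so that products of paths become concatenations and no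
  vertices have to be carried along; \<open>path_elt_in_ideal_iff\<close> ties it to
  \<open>I\<close> on walks.\<close>

definition null :: "'e list \<Rightarrow> bool" where
  "null xs \<longleftrightarrow> (\<exists>m \<in> rho. sublist (snd m) xs)"

abbreviation act :: "'e list \<Rightarrow> 'x \<Rightarrow> 'x" where
  "act xs \<equiv> fold (amap X) xs"

lemma rho_length: "m \<in> rho \<Longrightarrow> 2 \<le> length (snd m)"
  and rho_paths: "m \<in> rho \<Longrightarrow> m \<in> paths Q"
  using monomial_ideal by (auto simp: monomial_ideal_def plen_def)

lemma path_elt_in_ideal_iff:
  assumes "awalk u xs v"
  shows "path_elt k (u, xs) \<in> I \<longleftrightarrow> null xs"
proof -
  have "rho \<subseteq> {p \<in> paths Q. snd p \<noteq> []}"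
    using rho_length rho_paths by fastforce
  moreover have "I = Idl\<^bsub>path_algebra k Q\<^esub> (path_elt k ` rho)"
    using monomial_ideal unfolding monomial_ideal_def by blast
  ultimately show ?thesis
    using path_elt_in_Idl_iff[OF field_k.one_not_zero _ awalk_imp_path(1)[OF assms]]
    by (simp add: null_def)
qed

lemma not_null_short:
  assumes "length xs \<le> 1"
  shows "\<not> null xs"
proof
  assume "null xs"
  then obtain m where "m \<in> rho" "sublist (snd m) xs" by (auto simp: null_def)
  with rho_length[of m] sublist_length_le[of "snd m" xs] assms show False by simp
qed

lemma null_append: "null xs \<or> null ys \<Longrightarrow> null (xs @ ys)"
  by (auto simp: null_def sublist_append)

lemma abelian_group_vmod: "v \<in> verts Q \<Longrightarrow> abelian_group (vmod X v)"
  using representation by (auto simp: quiver_representation_def left_module_def)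

lemma act_hom:
  "awalk u xs v \<Longrightarrow> abelian_group_hom (vmod X u) (vmod X v) (act xs)"
proof (induction xs arbitrary: u)
  case Nil
  then have "u = v" "u \<in> verts Q" by (auto simp: awalk_Nil_iff)
  then show ?case
    by (intro abelian_group_homI abelian_group_vmod group_hom.intro group_hom_axioms.intro
        abelian_group.a_group) (auto simp: hom_def)
next
  case (Cons e xs)
  then have e: "e \<in> arcs Q" "u = tail Q e" and xs: "awalk (head Q e) xs v"
    by (auto simp: awalk_Cons_iff)
  from e representation have "amap X e \<in> module_maps A (vmod X u) (vmod X (head Q e))"
    by (simp add: quiver_representation_def)
  then have "amap X e \<in> hom (add_monoid (vmod X u)) (add_monoid (vmod X (head Q e)))"
    by (auto simp: module_maps_def hom_def)
  moreover have hom: "abelian_group_hom (vmod X (head Q e)) (vmod X v) (act xs)"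
    by (rule Cons.IH[OF xs])
  ultimately have "act xs \<circ> amap X e \<in> hom (add_monoid (vmod X u)) (add_monoid (vmod X v))"
    using group_hom.homh[OF abelian_group_hom.a_group_hom[OF hom]]
    by (intro hom_compose)
  then show ?case
    using abelian_group_hom.axioms(1,2)[OF hom] e Cons.prems
    by (intro abelian_group_homI abelian_group_vmod group_hom.intro group_hom_axioms.intro
        abelian_group.a_group) (auto simp: comp_def)
qed

text \<open>The relations are imposed on \<open>rho\<close> only. A null list contains a generator;
  the arrows before it lead into its domain, and the arrows after it preserve zero.\<close>

lemma act_null:
  assumes "awalk u xs v" "null xs" "x \<in> carrier (vmod X u)"
  shows "act xs x = \<zero>\<^bsub>vmod X v\<^esub>"
proof -
  obtain m ys zs where m: "m \<in> rho" and eq: "xs = ys @ snd m @ zs"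
    using assms(2) by (auto simp: null_def sublist_def)
  then obtain w w' where w: "awalk u ys w" "awalk w (snd m) w'" "awalk w' zs v"
    using assms(1) by auto
  have "awalk (fst m) (snd m) (ptgt Q m)" "snd m \<noteq> []"
    using rho_paths[OF m] rho_length[OF m] by (auto simp: mem_paths_iff)
  with w(2) have "fst m = w" "ptgt Q m = w'"
    by (cases "snd m"; auto simp: awalk_Cons_iff ptgt_def)+
  moreover have "act ys x \<in> carrier (vmod X w)"
    using abelian_group_hom.hom_closed[OF act_hom[OF w(1)]] assms by simp
  ultimately have "act (snd m) (act ys x) = \<zero>\<^bsub>vmod X w'\<^esub>"
    using representation m by (auto simp: quiver_representation_def pmap_def psrc_def)
  then show ?thesis
    using abelian_group_hom.hom_zero[OF act_hom[OF w(3)]] by (simp add: eq)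
qed

lemma in_arcs_hom:
  assumes "\<beta> \<in> in_arcs Q v"
  shows "abelian_group_hom (vmod X (tail Q \<beta>)) (vmod X v) (amap X \<beta>)"
  using act_hom[of "tail Q \<beta>" "[\<beta>]" v] assms head_in_verts[of \<beta>] by (simp add: awalk_simps)

section \<open>Kernels of paths as sums of images\<close>

abbreviation ker where "ker u xs \<equiv> ker_path Q X (u, xs)"
abbreviation ksum where "ksum u xs \<equiv> submodule_sum (vmod X u) (kernel_paths k Q I (u, xs)) (im_path X)"

lemma mem_ker_iff:
  "awalk u xs v \<Longrightarrow> x \<in> ker u xs \<longleftrightarrow> x \<in> carrier (vmod X u) \<and> act xs x = \<zero>\<^bsub>vmod X v\<^esub>"
  using awalk_imp_path[of u xs v] by (simp add: ker_path_def a_kernel_def' psrc_def pmap_def)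

lemma ker_additive_subgroup:
  "awalk u xs v \<Longrightarrow> additive_subgroup (ker u xs) (vmod X u)"
  using abelian_group_hom.additive_subgroup_a_kernel[OF act_hom] awalk_imp_path(2)[of u xs v]
  by (simp add: ker_path_def psrc_def pmap_def)

lemma im_path_additive_subgroup:
  assumes "awalk u xs v"
  shows "additive_subgroup (im_path X (u, xs)) (vmod X v)"
proof -
  interpret abelian_group_hom "vmod X u" "vmod X v" "act xs"
    by (rule act_hom[OF assms])
  have "additive_subgroup (carrier (vmod X u)) (vmod X u)"
    by (intro additive_subgroupI G.add.subgroup_self)
  from additive_subgroup_image[OF this] show ?thesis
    by (simp add: im_path_def psrc_def pmap_def)
qed

text \<open>The last arrow \<open>\<beta>\<close> of \<open>q\<close> is the one next to
  \<open>p\<close>. In order of traversal \<open>p q\<close> is \<open>ys @ \<beta> # xs\<close>,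
  which can also be read as \<open>ys\<close> followed by the longer path
  \<open>\<beta> # xs\<close>.\<close>

lemma kernel_pathsE:
  assumes "q \<in> kernel_paths k Q I (u, xs)" "awalk u xs v"
  obtains t ys \<beta> where "q = (t, ys @ [\<beta>])" "awalk t ys (tail Q \<beta>)" "\<beta> \<in> in_arcs Q u"
    "\<not> null (ys @ [\<beta>])" "null (ys @ \<beta> # xs)"
proof -
  obtain t zs where q: "q = (t, zs)" by fastforce
  have zs: "awalk t zs u" "zs \<noteq> []"
    using assms by (auto simp: kernel_paths_def q mem_paths_iff psrc_def plen_def)
  then obtain ys \<beta> where ys: "zs = ys @ [\<beta>]"
    by (metis append_butlast_last_id)
  have "path_elt k (t, zs @ xs) \<in> I" "path_elt k (t, zs) \<notin> I"
    using assms by (auto simp: kernel_paths_def q pcomp_def)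
  then have "null (zs @ xs)" "\<not> null zs"
    using path_elt_in_ideal_iff[of t "zs @ xs" v] path_elt_in_ideal_iff[of t zs u] zs assms(2) by auto
  then show thesis
    using that[OF _ , of t ys \<beta>] zs ys q by (auto simp: awalk_simps)
qed

lemma kernel_pathsI:
  assumes "awalk t ys u" "awalk u xs v" "ys \<noteq> []" "\<not> null ys" "null (ys @ xs)"
  shows "(t, ys) \<in> kernel_paths k Q I (u, xs)"
  using assms path_elt_in_ideal_iff[of t "ys @ xs" v] path_elt_in_ideal_iff[of t ys u]
    awalk_imp_path[of t ys u]
  by (auto simp: kernel_paths_def psrc_def pcomp_def plen_def Suc_le_eq)

lemma kernel_paths_im_additive_subgroup:
  "q \<in> kernel_paths k Q I (u, xs) \<Longrightarrow> additive_subgroup (im_path X q) (vmod X u)"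
  using im_path_additive_subgroup[of "fst q" "snd q" u]
  by (auto simp: kernel_paths_def mem_paths_iff psrc_def)

lemma ksum_additive_subgroup:
  assumes "awalk u xs v"
  shows "additive_subgroup (ksum u xs) (vmod X u)"
  using assms by (intro submodule_sum_additive_subgroup abelian_group_vmod kernel_paths_im_additive_subgroup) auto

text \<open>The easy half of (1): for \<open>q\<close> in the index set \<open>p q\<close> lies in
  \<open>I\<close>, so \<open>X\<^sub>p X\<^sub>q = 0\<close>.\<close>

lemma ksum_subset_ker:
  assumes "awalk u xs v"
  shows "ksum u xs \<subseteq> ker u xs"
proof (rule submodule_sum_least)
  interpret ker: additive_subgroup "ker u xs" "vmod X u"
    by (rule ker_additive_subgroup[OF assms])
  show "abelian_group (vmod X u)"
    using assms by (auto intro: abelian_group_vmod)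
  show "ker u xs \<subseteq> carrier (vmod X u)" "\<zero>\<^bsub>vmod X u\<^esub> \<in> ker u xs"
    by (auto intro: ker.a_subset)
  show "x \<oplus>\<^bsub>vmod X u\<^esub> y \<in> ker u xs" if "x \<in> ker u xs" "y \<in> ker u xs" for x y
    using that by (rule ker.a_closed)
  fix q assume q: "q \<in> kernel_paths k Q I (u, xs)"
  from q assms show "im_path X q \<subseteq> ker u xs"
  proof (rule kernel_pathsE)
    fix t ys \<beta>
    assume *: "q = (t, ys @ [\<beta>])" "awalk t ys (tail Q \<beta>)" "\<beta> \<in> in_arcs Q u" "null (ys @ \<beta> # xs)"
    then have walk: "awalk t (ys @ [\<beta>]) u" "awalk t (ys @ \<beta> # xs) v"
      using assms by (auto simp: awalk_simps)
    show ?thesis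
    proof
      fix x assume "x \<in> im_path X q"
      then obtain z where z: "z \<in> carrier (vmod X t)" "x = act (ys @ [\<beta>]) z"
        by (auto simp: im_path_def * psrc_def pmap_def)
      then show "x \<in> ker u xs"
        using abelian_group_hom.hom_closed[OF act_hom[OF walk(1)], of z] act_null[OF walk(2) *(4), of z]
        by (simp add: mem_ker_iff[OF assms])
    qed
  qed
qed

text \<open>Presents a single \<open>X\<^sub>\<beta> x\<close> as a sum over all incoming arrows, so
  that it can be compared with other such sums component by component.\<close>

lemma finsum_arrow_delta:
  assumes "\<beta> \<in> in_arcs Q u" "x \<in> carrier (vmod X (tail Q \<beta>))"
  shows "(\<Oplus>\<^bsub>vmod X u\<^esub>\<gamma>\<in>in_arcs Q u. amap X \<gamma> (if \<gamma> = \<beta> then x else \<zero>\<^bsub>vmod X (tail Q \<gamma>)\<^esub>)) =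
    amap X \<beta> x"
proof -
  interpret abelian_group_hom "vmod X (tail Q \<beta>)" "vmod X u" "amap X \<beta>"
    by (rule in_arcs_hom[OF assms(1)])
  have ax: "amap X \<beta> x \<in> carrier (vmod X u)"
    using assms(2) by (rule hom_closed)
  have "amap X \<gamma> (if \<gamma> = \<beta> then x else \<zero>\<^bsub>vmod X (tail Q \<gamma>)\<^esub>) =
      (if \<beta> = \<gamma> then amap X \<beta> x else \<zero>\<^bsub>vmod X u\<^esub>)" if "\<gamma> \<in> in_arcs Q u" for \<gamma>
    using abelian_group_hom.hom_zero[OF in_arcs_hom[OF that]] by simp
  then have "(\<Oplus>\<^bsub>vmod X u\<^esub>\<gamma>\<in>in_arcs Q u. amap X \<gamma> (if \<gamma> = \<beta> then x else \<zero>\<^bsub>vmod X (tail Q \<gamma>)\<^esub>)) =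
      (\<Oplus>\<^bsub>vmod X u\<^esub>\<gamma>\<in>in_arcs Q u. if \<beta> = \<gamma> then amap X \<beta> x else \<zero>\<^bsub>vmod X u\<^esub>)"
    using ax by (intro H.finsum_cong' refl) (simp_all add: Pi_def)
  also have "\<dots> = amap X \<beta> x"
    by (rule H.finsum_singleton) (use assms ax finite_in_arcs in simp_all)
  finally show ?thesis .
qed

text \<open>Write \<open>q = \<beta> q'\<close> for a path \<open>q\<close> in the index set of the
  sum for \<open>p\<close>. If \<open>p \<beta>\<close> is not in \<open>I\<close>, then
  \<open>q'\<close> is not trivial because \<open>p q\<close> is in \<open>I\<close>, it is non-zero
  as a part of \<open>q\<close>, and \<open>p \<beta> q'\<close> is in \<open>I\<close>; so
  \<open>q'\<close> occurs in the sum for \<open>p \<beta>\<close>. If \<open>p \<beta>\<close> is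
  in \<open>I\<close>, then \<open>q'\<close> may be trivial, and nothing better than the whole
  module at the tail of \<open>\<beta>\<close> can be claimed.\<close>

lemma ksum_decomposition:
  assumes walk: "awalk u xs v" and x: "x \<in> ksum u xs"
  obtains y where "\<And>\<beta>. \<beta> \<in> in_arcs Q u \<Longrightarrow> y \<beta> \<in> carrier (vmod X (tail Q \<beta>))"
    and "\<And>\<beta>. \<beta> \<in> in_arcs Q u \<Longrightarrow> \<not> null (\<beta> # xs) \<Longrightarrow> y \<beta> \<in> ksum (tail Q \<beta>) (\<beta> # xs)"
    and "x = (\<Oplus>\<^bsub>vmod X u\<^esub>\<beta>\<in>in_arcs Q u. amap X \<beta> (y \<beta>))"
proof -
  let ?M = "vmod X u" and ?E = "in_arcs Q u"
  have "u \<in> verts Q" using walk by auto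
  then interpret M: abelian_group ?M by (rule abelian_group_vmod)
  \<comment> \<open>The range of the component at \<open>\<beta>\<close> in the two cases. The sums
    with components in \<open>T\<close> form a set that is closed under addition and contains each
    image, so minimality of the sum applies.\<close>
  define T where "T \<beta> = (if null (\<beta> # xs) then carrier (vmod X (tail Q \<beta>)) else ksum (tail Q \<beta>) (\<beta> # xs))" for \<beta>
  define H where "H = {x. \<exists>y. (\<forall>\<beta> \<in> ?E. y \<beta> \<in> T \<beta>) \<and> x = (\<Oplus>\<^bsub>?M\<^esub>\<beta>\<in>?E. amap X \<beta> (y \<beta>))}"
  have T: "additive_subgroup (T \<beta>) (vmod X (tail Q \<beta>))" if "\<beta> \<in> ?E" for \<beta>
  proof -
    have "awalk (tail Q \<beta>) (\<beta> # xs) v"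
      using that walk by (auto simp: awalk_simps)
    moreover from this have "abelian_group (vmod X (tail Q \<beta>))"
      using abelian_group_vmod by auto
    ultimately show ?thesis
      unfolding T_def using ksum_additive_subgroup
      by (auto intro!: additive_subgroupI abelian_group.a_group group.subgroup_self[OF abelian_group.a_group, simplified])
  qed
  note T_sub = additive_subgroup.a_subset[OF T]
  have amap_T: "amap X \<beta> z \<in> carrier ?M" if "\<beta> \<in> ?E" "z \<in> T \<beta>" for \<beta> z
    using abelian_group_hom.hom_closed[OF in_arcs_hom[OF that(1)]] T_sub[OF that(1)] that(2) by blast
  have "ksum u xs \<subseteq> H"
  proof (rule submodule_sum_least)
    show "abelian_group ?M" ..
    show "H \<subseteq> carrier ?M"
      by (auto simp: H_def amap_T intro!: M.finsum_closed)
    have "(\<Oplus>\<^bsub>?M\<^esub>\<beta>\<in>?E. amap X \<beta> \<zero>\<^bsub>vmod X (tail Q \<beta>)\<^esub>) = \<zero>\<^bsub>?M\<^esub>"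
      by (rule M.add.finprod_one_eqI) (rule abelian_group_hom.hom_zero[OF in_arcs_hom])
    then show "\<zero>\<^bsub>?M\<^esub> \<in> H"
      unfolding H_def using additive_subgroup.zero_closed[OF T]
      by (intro CollectI exI[of _ "\<lambda>\<beta>. \<zero>\<^bsub>vmod X (tail Q \<beta>)\<^esub>"]) auto
    fix a b assume "a \<in> H" "b \<in> H"
    then obtain y z where y: "\<And>\<beta>. \<beta> \<in> ?E \<Longrightarrow> y \<beta> \<in> T \<beta>" "a = (\<Oplus>\<^bsub>?M\<^esub>\<beta>\<in>?E. amap X \<beta> (y \<beta>))"
      and z: "\<And>\<beta>. \<beta> \<in> ?E \<Longrightarrow> z \<beta> \<in> T \<beta>" "b = (\<Oplus>\<^bsub>?M\<^esub>\<beta>\<in>?E. amap X \<beta> (z \<beta>))"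
      unfolding H_def by blast
    define yz where "yz \<beta> = y \<beta> \<oplus>\<^bsub>vmod X (tail Q \<beta>)\<^esub> z \<beta>" for \<beta>
    have "a \<oplus>\<^bsub>?M\<^esub> b = (\<Oplus>\<^bsub>?M\<^esub>\<beta>\<in>?E. amap X \<beta> (y \<beta>) \<oplus>\<^bsub>?M\<^esub> amap X \<beta> (z \<beta>))"
      unfolding y(2) z(2) by (rule M.finsum_addf[symmetric]) (use y(1) z(1) amap_T in blast)+
    also have "\<dots> = (\<Oplus>\<^bsub>?M\<^esub>\<beta>\<in>?E. amap X \<beta> (yz \<beta>))"
    proof (intro M.finsum_cong' refl funcsetI)
      fix \<beta> assume \<beta>: "\<beta> \<in> ?E"
      show "amap X \<beta> (yz \<beta>) \<in> carrier ?M"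
        using additive_subgroup.a_closed[OF T[OF \<beta>] y(1)[OF \<beta>] z(1)[OF \<beta>]] amap_T[OF \<beta>] by (simp add: yz_def)
      show "amap X \<beta> (y \<beta>) \<oplus>\<^bsub>?M\<^esub> amap X \<beta> (z \<beta>) = amap X \<beta> (yz \<beta>)"
        using abelian_group_hom.hom_add[OF in_arcs_hom[OF \<beta>], of "y \<beta>" "z \<beta>"] T_sub[OF \<beta>] y(1)[OF \<beta>] z(1)[OF \<beta>]
        by (simp add: yz_def subset_eq)
    qed
    finally show "a \<oplus>\<^bsub>?M\<^esub> b \<in> H"
      unfolding H_def using additive_subgroup.a_closed[OF T] y(1) z(1)
      by (intro CollectI exI[of _ yz]) (simp add: yz_def)
  next
    fix q assume "q \<in> kernel_paths k Q I (u, xs)"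
    from this walk show "im_path X q \<subseteq> H"
    proof (rule kernel_pathsE)
      fix t ys \<beta>
      assume *: "q = (t, ys @ [\<beta>])" "awalk t ys (tail Q \<beta>)" "\<beta> \<in> in_arcs Q u"
        "\<not> null (ys @ [\<beta>])" "null (ys @ \<beta> # xs)"
      have im_T: "im_path X (t, ys) \<subseteq> T \<beta>"
      proof (cases "null (\<beta> # xs)")
        case True
        then show ?thesis
          using im_path_additive_subgroup[OF *(2)] by (simp add: T_def additive_subgroup.a_subset)
      next
        case False
        then have "ys \<noteq> []" using *(5) by auto
        moreover have "\<not> null ys" using *(4) null_append by blast
        moreover have "awalk (tail Q \<beta>) (\<beta> # xs) v"
          using * walk by (auto simp: awalk_simps)
        ultimately have "(t, ys) \<in> kernel_paths k Q I (tail Q \<beta>, \<beta> # xs)"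
          using * by (intro kernel_pathsI)
        with False show ?thesis
          using im_path_additive_subgroup[OF *(2)] *(2)
          by (auto simp: T_def intro!: submodule_sum_upper[THEN subsetD] abelian_group_vmod additive_subgroup.a_subset)
      qed
      show ?thesis
      proof
        fix x assume "x \<in> im_path X q"
        then obtain c where c: "x = amap X \<beta> c" "c \<in> im_path X (t, ys)"
          by (auto simp: im_path_def * psrc_def pmap_def)
        define y where "y \<gamma> = (if \<gamma> = \<beta> then c else \<zero>\<^bsub>vmod X (tail Q \<gamma>)\<^esub>)" for \<gamma>
        have y: "y \<gamma> \<in> T \<gamma>" if "\<gamma> \<in> ?E" for \<gamma>
          using im_T c(2) additive_subgroup.zero_closed[OF T[OF that]] by (auto simp: y_def)
        have "(\<Oplus>\<^bsub>?M\<^esub>\<gamma>\<in>?E. amap X \<gamma> (y \<gamma>)) = x"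
          unfolding y_def c(1) using c(2) im_T T_sub[OF *(3)] by (intro finsum_arrow_delta *(3)) blast
        then show "x \<in> H"
          unfolding H_def using y by (intro CollectI exI[of _ y]) simp
      qed
    qed
  qed
  with x obtain y where y: "\<And>\<beta>. \<beta> \<in> ?E \<Longrightarrow> y \<beta> \<in> T \<beta>" "x = (\<Oplus>\<^bsub>?M\<^esub>\<beta>\<in>?E. amap X \<beta> (y \<beta>))"
    unfolding H_def by blast
  show thesis
  proof (rule that[of y])
    show "y \<beta> \<in> carrier (vmod X (tail Q \<beta>))" if "\<beta> \<in> ?E" for \<beta>
      using y(1)[OF that] T_sub[OF that] by blast
    show "y \<beta> \<in> ksum (tail Q \<beta>) (\<beta> # xs)" if "\<beta> \<in> ?E" "\<not> null (\<beta> # xs)" for \<beta>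
      using y(1)[OF that(1)] that(2) by (simp add: T_def)
  qed (rule y(2))
qed

lemma im_arrow: "im_path X (arrow_path Q \<beta>) = amap X \<beta> ` carrier (vmod X (tail Q \<beta>))"
  by (simp add: im_path_def arrow_path_def psrc_def pmap_def)

lemma im_arrow_additive_subgroup:
  "\<beta> \<in> in_arcs Q u \<Longrightarrow> additive_subgroup (im_path X (arrow_path Q \<beta>)) (vmod X u)"
  using im_path_additive_subgroup[of "tail Q \<beta>" "[\<beta>]" u] head_in_verts[of \<beta>]
  by (simp add: arrow_path_def awalk_simps)

text \<open>This is (m1) in terms of preimages. The conclusion concerns the images only, since
  \<open>y\<close> and \<open>z\<close> may differ by elements of the kernels of the arrows.\<close>

lemma arrow_components_unique:
  assumes "u \<in> verts Q" "\<beta> \<in> in_arcs Q u"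
    and y: "\<And>\<gamma>. \<gamma> \<in> in_arcs Q u \<Longrightarrow> y \<gamma> \<in> carrier (vmod X (tail Q \<gamma>))"
    and z: "\<And>\<gamma>. \<gamma> \<in> in_arcs Q u \<Longrightarrow> z \<gamma> \<in> carrier (vmod X (tail Q \<gamma>))"
    and eq: "(\<Oplus>\<^bsub>vmod X u\<^esub>\<gamma>\<in>in_arcs Q u. amap X \<gamma> (y \<gamma>)) = (\<Oplus>\<^bsub>vmod X u\<^esub>\<gamma>\<in>in_arcs Q u. amap X \<gamma> (z \<gamma>))"
  shows "amap X \<beta> (y \<beta>) = amap X \<beta> (z \<beta>)"
proof (rule direct_family_unique[OF abelian_group_vmod[OF assms(1)] _ im_arrow_additive_subgroup _ _ _ _ eq assms(2)])
  show "direct_family (vmod X u) (in_arcs Q u) (\<lambda>\<alpha>. im_path X (arrow_path Q \<alpha>))"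
    using monic assms(1) by (simp add: monic_rep_def)
qed (use y z finite_in_arcs in \<open>simp_all add: im_arrow\<close>)

text \<open>Condition (m2) is the case of (1) in which the path is a single arrow.\<close>

lemma ker_arrow:
  assumes "\<beta> \<in> arcs Q"
  shows "ker (tail Q \<beta>) [\<beta>] = ksum (tail Q \<beta>) [\<beta>]"
proof -
  have "{q \<in> nz_paths_to k Q I (tail Q \<beta>). path_elt k (pcomp (arrow_path Q \<beta>) q) \<in> I} =
      kernel_paths k Q I (tail Q \<beta>, [\<beta>])"
    by (auto simp: nz_paths_to_def kernel_paths_def arrow_path_def psrc_def)
  with monic assms show ?thesis
    by (simp add: monic_rep_def arrow_path_def)
qed

text \<open>
  Peeling off the first arrow \<open>\<beta>\<close> of the path: \<open>X\<^sub>\<beta> x\<close> lies in the kernel of the remaining path, and by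
  directness only the summands of \<open>ksum_decomposition\<close> belonging to \<open>\<beta>\<close> contribute to it.
\<close>

lemma ker_eq_ksum:
  "awalk u xs v \<Longrightarrow> \<not> null xs \<Longrightarrow> ker u xs = ksum u xs"
proof (induction xs arbitrary: u)
  \<comment> \<open>The trivial path acts as the identity and has kernel zero. Starting here makes a
    single arrow an instance of the induction step.\<close>
  case Nil
  then have "ker u [] \<subseteq> {\<zero>\<^bsub>vmod X u\<^esub>}"
    by (auto simp: mem_ker_iff awalk_Nil_iff)
  moreover have "\<zero>\<^bsub>vmod X u\<^esub> \<in> ksum u []"
    using Nil by (intro zero_in_submodule_sum abelian_group_vmod) auto
  ultimately show ?case
    using ksum_subset_ker[OF Nil.prems(1)] by blast
next
  case (Cons \<beta> xs)
  then have \<beta>: "\<beta> \<in> arcs Q" "u = tail Q \<beta>" "\<beta> \<in> in_arcs Q (head Q \<beta>)" and walk: "awalk (head Q \<beta>) xs v"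
    by (auto simp: awalk_Cons_iff)
  have "\<not> null xs"
    using Cons.prems(2) null_append[of "[\<beta>]" xs] by auto
  note IH = Cons.IH[OF walk this]
  interpret amap: abelian_group_hom "vmod X u" "vmod X (head Q \<beta>)" "amap X \<beta>"
    using in_arcs_hom[OF \<beta>(3)] \<beta>(2) by simp
  interpret ksum: additive_subgroup "ksum u (\<beta> # xs)" "vmod X u"
    by (rule ksum_additive_subgroup[OF Cons.prems(1)])
  have "x \<in> ksum u (\<beta> # xs)" if "x \<in> ker u (\<beta> # xs)" for x
  proof -
    have x: "x \<in> carrier (vmod X u)" "act xs (amap X \<beta> x) = \<zero>\<^bsub>vmod X v\<^esub>"
      using that by (simp_all add: mem_ker_iff[OF Cons.prems(1)])
    then have "amap X \<beta> x \<in> ksum (head Q \<beta>) xs"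
      using IH by (auto simp flip: IH simp: mem_ker_iff[OF walk])
    then obtain y where y: "\<And>\<gamma>. \<gamma> \<in> in_arcs Q (head Q \<beta>) \<Longrightarrow> y \<gamma> \<in> carrier (vmod X (tail Q \<gamma>))"
      and y_ksum: "\<And>\<gamma>. \<gamma> \<in> in_arcs Q (head Q \<beta>) \<Longrightarrow> \<not> null (\<gamma> # xs) \<Longrightarrow> y \<gamma> \<in> ksum (tail Q \<gamma>) (\<gamma> # xs)"
      and sum: "amap X \<beta> x = (\<Oplus>\<^bsub>vmod X (head Q \<beta>)\<^esub>\<gamma>\<in>in_arcs Q (head Q \<beta>). amap X \<gamma> (y \<gamma>))"
      by (rule ksum_decomposition[OF walk]) blast
    \<comment> \<open>A second expansion of \<open>X\<^sub>\<beta> x\<close>, concentrated at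
      \<open>\<beta>\<close>. Comparison with \<open>y\<close> at \<open>\<beta>\<close> gives
      \<open>X\<^sub>\<beta> x = X\<^sub>\<beta> (y \<beta>)\<close>, so \<open>x\<close> and
      \<open>y \<beta>\<close> differ by an element of \<open>Ker X\<^sub>\<beta>\<close>.\<close>
    define z where "z \<gamma> = (if \<gamma> = \<beta> then x else \<zero>\<^bsub>vmod X (tail Q \<gamma>)\<^esub>)" for \<gamma>
    have "z \<gamma> \<in> carrier (vmod X (tail Q \<gamma>))" if "\<gamma> \<in> in_arcs Q (head Q \<beta>)" for \<gamma>
      using x \<beta>(2) abelian_groupE(2)[OF abelian_group_hom.axioms(1)[OF in_arcs_hom[OF that]]]
      by (simp add: z_def)
    moreover have "(\<Oplus>\<^bsub>vmod X (head Q \<beta>)\<^esub>\<gamma>\<in>in_arcs Q (head Q \<beta>). amap X \<gamma> (z \<gamma>)) = amap X \<beta> x"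
      unfolding z_def using x \<beta> by (intro finsum_arrow_delta) simp_all
    ultimately have "amap X \<beta> (z \<beta>) = amap X \<beta> (y \<beta>)"
      using \<beta> y sum by (intro arrow_components_unique[of "head Q \<beta>"]) simp_all
    then have eq: "amap X \<beta> x = amap X \<beta> (y \<beta>)"
      by (simp add: z_def)
    have y\<beta>: "y \<beta> \<in> carrier (vmod X u)" "y \<beta> \<in> ksum u (\<beta> # xs)"
      using y[OF \<beta>(3)] y_ksum[OF \<beta>(3)] Cons.prems(2) \<beta>(2) by simp_all
    have w\<beta>: "awalk u [\<beta>] (head Q \<beta>)"
      using \<beta> by (simp add: awalk_simps)
    have "x \<oplus>\<^bsub>vmod X u\<^esub> \<ominus>\<^bsub>vmod X u\<^esub> y \<beta> \<in> ker u [\<beta>]"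
      using x y\<beta> eq by (simp add: mem_ker_iff[OF w\<beta>] amap.H.r_neg)
    then have "x \<oplus>\<^bsub>vmod X u\<^esub> \<ominus>\<^bsub>vmod X u\<^esub> y \<beta> \<in> ksum u [\<beta>]"
      using ker_arrow[OF \<beta>(1)] \<beta>(2) by simp
    \<comment> \<open>A path whose product with \<open>\<beta>\<close> is in \<open>I\<close> also
      has its product with the whole path in \<open>I\<close>, so the sum that (m2) gives for
      \<open>\<beta>\<close> is part of the required one.\<close>
    moreover have "kernel_paths k Q I (u, [\<beta>]) \<subseteq> kernel_paths k Q I (u, \<beta> # xs)"
    proof
      fix q assume "q \<in> kernel_paths k Q I (u, [\<beta>])"
      from this w\<beta> obtain t ys \<gamma> where q: "q = (t, ys @ [\<gamma>])" "awalk t ys (tail Q \<gamma>)" "\<gamma> \<in> in_arcs Q u"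
        "\<not> null (ys @ [\<gamma>])" "null (ys @ [\<gamma>, \<beta>])"
        by (rule kernel_pathsE)
      have "null ((ys @ [\<gamma>, \<beta>]) @ xs)"
        using q(5) by (intro null_append) simp
      with q Cons.prems(1) show "q \<in> kernel_paths k Q I (u, \<beta> # xs)"
        by (auto intro!: kernel_pathsI simp: awalk_simps)
    qed
    then have "ksum u [\<beta>] \<subseteq> ksum u (\<beta> # xs)"
      unfolding submodule_sum_def by blast
    ultimately have "x \<oplus>\<^bsub>vmod X u\<^esub> \<ominus>\<^bsub>vmod X u\<^esub> y \<beta> \<oplus>\<^bsub>vmod X u\<^esub> y \<beta> \<in> ksum u (\<beta> # xs)"
      using y\<beta>(2) by blast
    then show ?thesis
      using x(1) y\<beta>(1) by (simp add: amap.G.a_assoc amap.G.l_neg)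
  qed
  then show ?case
    using ksum_subset_ker[OF Cons.prems(1)] by blast
qed

text \<open>By (1) the sum lies in \<open>ksum u xs\<close> and has a second expansion
  \<open>y\<close> by \<open>ksum_decomposition\<close>. Each \<open>y \<beta>\<close> is killed by
  \<open>\<beta> # xs\<close>, either because that path is null or because \<open>y \<beta>\<close>
  lies in its kernel sum, and uniqueness of the images transfers this to
  \<open>z \<beta>\<close>.\<close>

lemma act_arrow_components_zero:
  assumes walk: "awalk u xs v" and nn: "\<not> null xs"
    and z: "\<And>\<gamma>. \<gamma> \<in> in_arcs Q u \<Longrightarrow> z \<gamma> \<in> carrier (vmod X (tail Q \<gamma>))"
    and zero: "act xs (\<Oplus>\<^bsub>vmod X u\<^esub>\<gamma>\<in>in_arcs Q u. amap X \<gamma> (z \<gamma>)) = \<zero>\<^bsub>vmod X v\<^esub>"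
    and \<beta>: "\<beta> \<in> in_arcs Q u"
  shows "act (\<beta> # xs) (z \<beta>) = \<zero>\<^bsub>vmod X v\<^esub>"
proof -
  let ?s = "\<Oplus>\<^bsub>vmod X u\<^esub>\<gamma>\<in>in_arcs Q u. amap X \<gamma> (z \<gamma>)"
  have u: "u \<in> verts Q" using walk by auto
  interpret M: abelian_group "vmod X u" by (rule abelian_group_vmod[OF u])
  have "?s \<in> carrier (vmod X u)"
    using z abelian_group_hom.hom_closed[OF in_arcs_hom] by (intro M.finsum_closed funcsetI) blast
  with zero have "?s \<in> ksum u xs"
    by (simp add: mem_ker_iff[OF walk] flip: ker_eq_ksum[OF walk nn])
  then obtain y where y: "\<And>\<gamma>. \<gamma> \<in> in_arcs Q u \<Longrightarrow> y \<gamma> \<in> carrier (vmod X (tail Q \<gamma>))"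
    and y_ksum: "\<And>\<gamma>. \<gamma> \<in> in_arcs Q u \<Longrightarrow> \<not> null (\<gamma> # xs) \<Longrightarrow> y \<gamma> \<in> ksum (tail Q \<gamma>) (\<gamma> # xs)"
    and sum: "?s = (\<Oplus>\<^bsub>vmod X u\<^esub>\<gamma>\<in>in_arcs Q u. amap X \<gamma> (y \<gamma>))"
    by (rule ksum_decomposition[OF walk]) blast
  have eq: "amap X \<beta> (z \<beta>) = amap X \<beta> (y \<beta>)"
    by (rule arrow_components_unique[OF u \<beta> z y sum])
  have w\<beta>: "awalk (tail Q \<beta>) (\<beta> # xs) v"
    using \<beta> walk by (auto simp: awalk_simps)
  have "act (\<beta> # xs) (y \<beta>) = \<zero>\<^bsub>vmod X v\<^esub>"
  proof (cases "null (\<beta> # xs)")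
    case True
    then show ?thesis by (rule act_null[OF w\<beta> _ y[OF \<beta>]])
  next
    case False
    from y_ksum[OF \<beta> this] ksum_subset_ker[OF w\<beta>] have "y \<beta> \<in> ker (tail Q \<beta>) (\<beta> # xs)"
      by blast
    then show ?thesis by (simp add: mem_ker_iff[OF w\<beta>])
  qed
  with eq show ?thesis by simp
qed

section \<open>Directness for paths with common start and end\<close>

lemma closed_awalk_empty:
  assumes "awalk u xs u"
  shows "xs = []"
proof (rule ccontr)
  assume "xs \<noteq> []"
  with assms have "closed_w xs" by (auto simp: closed_w_def)
  from closed_w_imp_cycle[OF this] acyclic show False
    by (simp add: acyclic_quiver_def)
qed

text \<open>
  The additional path \<open>ws\<close> after the paths in \<open>F\<close> makes the induction on their lengths work.
\<close>

lemma act_path_components_zero: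
  assumes "awalk v ws i" "finite F" "\<And>ys. ys \<in> F \<Longrightarrow> awalk j ys v" "\<And>ys. ys \<in> F \<Longrightarrow> length ys \<le> n"
    and "x \<in> F \<rightarrow> carrier (vmod X j)"
    and "act ws (\<Oplus>\<^bsub>vmod X v\<^esub>ys\<in>F. act ys (x ys)) = \<zero>\<^bsub>vmod X i\<^esub>"
    and "ys \<in> F"
  shows "act ws (act ys (x ys)) = \<zero>\<^bsub>vmod X i\<^esub>"
  using assms
proof (induction n arbitrary: v ws F x ys)
  case (0 v ws F x ys)
  from 0(4) have "F \<subseteq> {[]}" by auto
  with 0(7) have F: "F = {[]}" "ys = []" by auto
  with 0(3,5) have "v = j" "x [] \<in> carrier (vmod X v)" "abelian_group (vmod X v)"
    using abelian_group_vmod by (auto simp: awalk_Nil_iff)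
  then show ?case
    using 0(6) by (simp add: F abelian_monoid.finsum_insert abelian_group.axioms abelian_monoid.finsum_empty abelian_monoid.r_zero)
next
  case (Suc n v ws F x ys)
  note walks = Suc.prems(3) and x = Suc.prems(5)
  consider "[] \<in> F" | "null ws" | "[] \<notin> F" "\<not> null ws" by blast
  then show ?case
  proof cases
    case 1
    \<comment> \<open>A trivial path cannot be split at its last arrow. But its presence means
      \<open>v = j\<close>, so all members of \<open>F\<close> are closed walks and hence empty by
      acyclicity. The smaller length bound then holds as well.\<close>
    with walks[OF 1] have "j = v" by (auto simp: awalk_Nil_iff)
    then have "length ys' \<le> n" if "ys' \<in> F" for ys'
      using closed_awalk_empty[of v ys'] walks[OF that] by simp
    then show ?thesis
      using Suc.prems by (intro Suc.IH[of v ws F x ys]) auto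
  next
    case 2
    have "awalk j (ys @ ws) i" "null (ys @ ws)"
      using awalk_appendI[OF walks[OF Suc.prems(7)] Suc.prems(1)] null_append[of ys ws] 2 by simp_all
    moreover have "x ys \<in> carrier (vmod X j)" using x Suc.prems by auto
    ultimately show ?thesis
      using act_null[of j "ys @ ws" i "x ys"] by simp
  next
    case 3
    let ?E = "in_arcs Q v"
    have v: "v \<in> verts Q" using Suc.prems(1) by auto
    interpret M: abelian_group "vmod X v" by (rule abelian_group_vmod[OF v])
    \<comment> \<open>\<open>F\<close> is the disjoint union over the arrows \<open>\<beta>\<close>
      into \<open>v\<close> of the lists in \<open>G \<beta>\<close> extended by
      \<open>\<beta>\<close>.\<close>
    define G where "G \<beta> = {zs. zs @ [\<beta>] \<in> F}" for \<beta>
    have fin: "finite (G \<beta>)" for \<beta>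
    proof -
      have "G \<beta> = (\<lambda>zs. zs @ [\<beta>]) -` F" by (auto simp: G_def)
      then show ?thesis using Suc.prems(2) by (simp add: finite_vimageI inj_def)
    qed
    have G_walk: "awalk j zs (tail Q \<beta>)" "\<beta> \<in> ?E" if "zs \<in> G \<beta>" for zs \<beta>
      using walks[of "zs @ [\<beta>]"] that by (auto simp: G_def awalk_simps)
    have F_eq: "F = (\<Union>\<beta>\<in>?E. (\<lambda>zs. zs @ [\<beta>]) ` G \<beta>)"
    proof -
      have "ys' \<in> (\<Union>\<beta>\<in>?E. (\<lambda>zs. zs @ [\<beta>]) ` G \<beta>)" if "ys' \<in> F" for ys'
      proof -
        have "ys' \<noteq> []" using 3(1) that by auto
        then have "butlast ys' @ [last ys'] = ys'" by simp
        moreover from this that have "butlast ys' \<in> G (last ys')" by (simp add: G_def)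
        ultimately show ?thesis using G_walk(2) by (intro UN_I[of "last ys'"] image_eqI[of _ _ "butlast ys'"]) auto
      qed
      then show ?thesis by (auto simp: G_def)
    qed
    have x_carrier: "x (zs @ [\<beta>]) \<in> carrier (vmod X j)" if "zs \<in> G \<beta>" for zs \<beta>
      using that x by (auto simp: G_def)
    have act_carrier: "act ys (x ys) \<in> carrier (vmod X v)" if "ys \<in> F" for ys
      using abelian_group_hom.hom_closed[OF act_hom[OF walks[OF that]]] x that by blast
    \<comment> \<open>The partial sum over the paths in \<open>F\<close> that end in
      \<open>\<beta>\<close>, taken before \<open>\<beta>\<close> is applied.\<close>
    define z where "z \<beta> = (\<Oplus>\<^bsub>vmod X (tail Q \<beta>)\<^esub>zs\<in>G \<beta>. act zs (x (zs @ [\<beta>])))" for \<beta>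
    have act_zs: "(\<lambda>zs. act zs (x (zs @ [\<beta>]))) \<in> G \<beta> \<rightarrow> carrier (vmod X (tail Q \<beta>))" for \<beta>
      using abelian_group_hom.hom_closed[OF act_hom[OF G_walk(1)]] x_carrier by blast
    have z_carrier: "z \<beta> \<in> carrier (vmod X (tail Q \<beta>))" if "\<beta> \<in> ?E" for \<beta>
      unfolding z_def using act_zs
      by (intro abelian_monoid.finsum_closed abelian_group.axioms abelian_group_hom.axioms(1)[OF in_arcs_hom[OF that]])
    have "(\<Oplus>\<^bsub>vmod X v\<^esub>ys\<in>F. act ys (x ys)) =
        (\<Oplus>\<^bsub>vmod X v\<^esub>\<beta>\<in>?E. \<Oplus>\<^bsub>vmod X v\<^esub>ys\<in>(\<lambda>zs. zs @ [\<beta>]) ` G \<beta>. act ys (x ys))"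
      by (subst F_eq, rule M.add.finprod_UN_disjoint)
        (use fin act_carrier in \<open>auto simp: G_def pairwise_def disjnt_def\<close>)
    also have "\<dots> = (\<Oplus>\<^bsub>vmod X v\<^esub>\<beta>\<in>?E. amap X \<beta> (z \<beta>))"
    proof (intro M.finsum_cong' refl funcsetI)
      fix \<beta> assume \<beta>: "\<beta> \<in> ?E"
      interpret amap: abelian_group_hom "vmod X (tail Q \<beta>)" "vmod X v" "amap X \<beta>"
        by (rule in_arcs_hom[OF \<beta>])
      show "amap X \<beta> (z \<beta>) \<in> carrier (vmod X v)"
        using z_carrier[OF \<beta>] by (rule amap.hom_closed)
      have "(\<Oplus>\<^bsub>vmod X v\<^esub>ys\<in>(\<lambda>zs. zs @ [\<beta>]) ` G \<beta>. act ys (x ys)) =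
          (\<Oplus>\<^bsub>vmod X v\<^esub>zs\<in>G \<beta>. act (zs @ [\<beta>]) (x (zs @ [\<beta>])))"
        by (rule M.finsum_reindex) (use act_carrier in \<open>auto simp: G_def inj_on_def\<close>)
      also have "\<dots> = amap X \<beta> (z \<beta>)"
        unfolding z_def by (subst amap.hom_finsum[OF act_zs]) simp
      finally show "(\<Oplus>\<^bsub>vmod X v\<^esub>ys\<in>(\<lambda>zs. zs @ [\<beta>]) ` G \<beta>. act ys (x ys)) = amap X \<beta> (z \<beta>)" .
    qed
    finally have sum: "(\<Oplus>\<^bsub>vmod X v\<^esub>ys\<in>F. act ys (x ys)) = (\<Oplus>\<^bsub>vmod X v\<^esub>\<beta>\<in>?E. amap X \<beta> (z \<beta>))" .
    \<comment> \<open>Since \<open>ws\<close> is not null, \<open>act_arrow_components_zero\<close>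
      isolates the part \<open>z \<beta>\<close>, which is killed by \<open>\<beta> # ws\<close>.
      The arrow \<open>\<beta>\<close> thus moves from the paths in \<open>F\<close> to the path
      after them, and the induction hypothesis applies to the shorter paths in
      \<open>G \<beta>\<close>.\<close>
    obtain \<beta> zs where ys: "ys = zs @ [\<beta>]" "\<beta> \<in> ?E" "zs \<in> G \<beta>"
      using Suc.prems(7) F_eq by blast
    have "act (\<beta> # ws) (z \<beta>) = \<zero>\<^bsub>vmod X i\<^esub>"
      by (rule act_arrow_components_zero[OF Suc.prems(1) 3(2) z_carrier _ ys(2)]) (use Suc.prems(6) sum in simp_all)
    moreover have "awalk (tail Q \<beta>) (\<beta> # ws) i"
      using Suc.prems(1) ys by (auto simp: awalk_simps)
    moreover have "length zs' \<le> n" if "zs' \<in> G \<beta>" for zs'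
      using Suc.prems(4)[of "zs' @ [\<beta>]"] that by (simp add: G_def)
    ultimately have "act (\<beta> # ws) (act zs (x (zs @ [\<beta>]))) = \<zero>\<^bsub>vmod X i\<^esub>"
      using fin G_walk(1) x_carrier ys(3) unfolding z_def
      by (intro Suc.IH[of "tail Q \<beta>" "\<beta> # ws" "G \<beta>" "\<lambda>zs. x (zs @ [\<beta>])" zs] funcsetI)
    then show ?thesis by (simp add: ys)
  qed
qed

text \<open>The members of the images are lifted to elements of the common source
  \<open>vmod X j\<close>; then \<open>act_path_components_zero\<close> applies with the trivial
  path at \<open>i\<close> as the additional path and the maximal length in \<open>F\<close> as the
  bound.\<close>

lemma direct_family_paths:
  assumes "i \<in> verts Q"
  shows "direct_family (vmod X i) (nz_paths_from_to k Q I j i) (im_path X)"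
  unfolding direct_family_def
proof (intro allI impI ballI, elim conjE)
  fix F x q
  assume F: "finite F" "F \<subseteq> nz_paths_from_to k Q I j i" and x: "x \<in> Pi F (im_path X)"
    and zero: "finsum (vmod X i) x F = \<zero>\<^bsub>vmod X i\<^esub>" and q: "q \<in> F"
  interpret M: abelian_group "vmod X i" by (rule abelian_group_vmod[OF assms])
  have walk: "fst r = j" "awalk j (snd r) i" if "r \<in> F" for r
    using that F(2) by (auto simp: nz_paths_from_to_def mem_paths_iff psrc_def)
  have "\<exists>c \<in> carrier (vmod X j). x r = act (snd r) c" if "r \<in> F" for r
  proof -
    have "x r \<in> im_path X r" using x that by blast
    with walk(1)[OF that] show ?thesis by (auto simp: im_path_def psrc_def pmap_def)
  qed
  then obtain c where c: "\<And>r. r \<in> F \<Longrightarrow> c r \<in> carrier (vmod X j)" "\<And>r. r \<in> F \<Longrightarrow> x r = act (snd r) (c r)"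
    by metis
  \<comment> \<open>As all paths in \<open>F\<close> start at \<open>j\<close>, they can be replaced
    by their lists of arrows as summation indices.\<close>
  have r_eq: "(j, snd r) = r" if "r \<in> F" for r
    using walk(1)[OF that] by (simp add: prod_eq_iff)
  have carrier: "act (snd r) (c r) \<in> carrier (vmod X i)" if "r \<in> F" for r
    using abelian_group_hom.hom_closed[OF act_hom[OF walk(2)[OF that]] c(1)[OF that]] .
  have "(\<Oplus>\<^bsub>vmod X i\<^esub>ys\<in>snd ` F. act ys (c (j, ys))) = (\<Oplus>\<^bsub>vmod X i\<^esub>r\<in>F. act (snd r) (c (j, snd r)))"
    by (rule M.finsum_reindex) (use carrier r_eq walk(1) in \<open>auto simp: inj_on_def prod_eq_iff\<close>)
  also have "\<dots> = finsum (vmod X i) x F"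
    by (intro M.finsum_cong' refl funcsetI) (use carrier r_eq c in auto)
  finally have "act [] (\<Oplus>\<^bsub>vmod X i\<^esub>ys\<in>snd ` F. act ys (c (j, ys))) = \<zero>\<^bsub>vmod X i\<^esub>"
    using zero by simp
  moreover have "awalk i [] i" using assms by (simp add: awalk_Nil_iff)
  moreover have "length ys \<le> Max (length ` snd ` F)" if "ys \<in> snd ` F" for ys
    using F(1) that by (intro Max_ge) auto
  ultimately have "act [] (act (snd q) (c (j, snd q))) = \<zero>\<^bsub>vmod X i\<^esub>"
    using F(1) q c(1) r_eq walk(2)
    by (intro act_path_components_zero[of i "[]" i "snd ` F" j "Max (length ` snd ` F)"]) auto
  then show "x q = \<zero>\<^bsub>vmod X i\<^esub>"
    using c(2)[OF q] r_eq[OF q] by simp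
qed

section \<open>The decomposition of a kernel by incoming arrows\<close>

lemma inj_on_if_ker_trivial:
  assumes "awalk u xs v" "ker u xs = {\<zero>\<^bsub>vmod X u\<^esub>}"
  shows "inj_on (act xs) (carrier (vmod X u))"
proof (rule abelian_group_hom.inj_on_if_trivial_a_kernel[OF act_hom[OF assms(1)]])
  show "a_kernel (vmod X u) (vmod X v) (act xs) = {\<zero>\<^bsub>vmod X u\<^esub>}"
    using assms(2) awalk_imp_path(2)[OF assms(1)] by (simp add: ker_path_def psrc_def pmap_def)
qed

text \<open>The generators of \<open>I\<close> have length at least two, so an arrow is a non-zero
  path and is itself a witness for being the last arrow of one.\<close>

lemma B1_eq:
  assumes "awalk u xs v"
  shows "B1 k Q I (u, xs) = {\<beta> \<in> in_arcs Q u. null (\<beta> # xs)}"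
proof -
  have "\<beta> \<in> B1 k Q I (u, xs) \<longleftrightarrow> null (\<beta> # xs)" if \<beta>: "\<beta> \<in> in_arcs Q u" for \<beta>
  proof -
    have walks: "awalk (tail Q \<beta>) [\<beta>] u" "awalk (tail Q \<beta>) (\<beta> # xs) v"
      using \<beta> assms by (auto simp: awalk_simps)
    then have "(tail Q \<beta>, [\<beta>]) \<in> nz_paths_to k Q I u"
      using awalk_imp_path[OF walks(1)] path_elt_in_ideal_iff[OF walks(1)] not_null_short[of "[\<beta>]"]
      by (simp add: nz_paths_to_def plen_def)
    then have "\<exists>q \<in> nz_paths_to k Q I u. \<beta> = last_arrow q"
      by (intro bexI[of _ "(tail Q \<beta>, [\<beta>])"]) (simp_all add: last_arrow_def)
    then show ?thesis
      using \<beta> path_elt_in_ideal_iff[OF walks(2)] by (auto simp: B1_def psrc_def pcomp_def arrow_path_def)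
  qed
  then show ?thesis
    by (auto simp: B1_def psrc_def)
qed

lemma B2_D:
  assumes "awalk u xs v" "\<beta> \<in> B2 k Q I (u, xs)"
  shows "\<beta> \<in> in_arcs Q u" "\<not> null (\<beta> # xs)"
proof -
  show \<beta>: "\<beta> \<in> in_arcs Q u"
    using assms(2) by (simp add: B2_def psrc_def)
  have "awalk (tail Q \<beta>) (\<beta> # xs) v"
    using \<beta> assms(1) by (auto simp: awalk_simps)
  from path_elt_in_ideal_iff[OF this] assms(2) show "\<not> null (\<beta> # xs)"
    by (auto simp: B2_def pcomp_def arrow_path_def)
qed

lemma B2_I:
  assumes "awalk u xs v" "\<beta> \<in> in_arcs Q u" "\<not> null (\<beta> # xs)"
    and "awalk t ys (tail Q \<beta>)" "\<not> null (ys @ [\<beta>])" "null (ys @ \<beta> # xs)"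
  shows "\<beta> \<in> B2 k Q I (u, xs)"
proof -
  have walks: "awalk t (ys @ [\<beta>]) u" "awalk t (ys @ \<beta> # xs) v" "awalk (tail Q \<beta>) (\<beta> # xs) v"
    using assms by (auto simp: awalk_simps)
  have "(t, ys @ [\<beta>]) \<in> nz_paths_to k Q I u"
    using awalk_imp_path[OF walks(1)] path_elt_in_ideal_iff[OF walks(1)] assms(5)
    by (simp add: nz_paths_to_def plen_def)
  moreover have "path_elt k (pcomp (u, xs) (t, ys @ [\<beta>])) \<in> I"
    using path_elt_in_ideal_iff[OF walks(2)] assms(6) by (simp add: pcomp_def)
  moreover have "path_elt k (pcomp (u, xs) (arrow_path Q \<beta>)) \<notin> I"
    using path_elt_in_ideal_iff[OF walks(3)] assms(3) by (simp add: pcomp_def arrow_path_def)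
  moreover have "\<beta> = last_arrow (t, ys @ [\<beta>])"
    by (simp add: last_arrow_def)
  ultimately show ?thesis
    unfolding B2_def psrc_def fst_conv using assms(2) by blast
qed

text \<open>Every \<open>N2 \<beta>\<close> lies in \<open>N1 \<beta>\<close>, the image of the
  arrow, so all claims of directness reduce to (m1). That the two sums exhaust the kernel follows
  from (1): for \<open>q = \<beta> q'\<close> in its index set, \<open>Im X\<^sub>q\<close> lies in
  \<open>N1 \<beta>\<close> with \<open>\<beta>\<close> in \<open>B1\<close> if
  \<open>p \<beta>\<close> is in \<open>I\<close>, and otherwise in \<open>N2 \<beta>\<close> with
  \<open>\<beta>\<close> in \<open>B2\<close>, because \<open>X\<^sub>q\<^sub>'\<close> maps into
  the kernel of \<open>p \<beta>\<close>.\<close>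

lemma ker_decomposition:
  assumes walk: "awalk u xs v" and nn: "\<not> null xs"
  defines "M \<equiv> vmod X u"
    and "N1 \<equiv> \<lambda>\<beta>. im_path X (arrow_path Q \<beta>)"
    and "N2 \<equiv> \<lambda>\<beta>. amap X \<beta> ` ker_path Q X (pcomp (u, xs) (arrow_path Q \<beta>))"
    and "K1 \<equiv> B1 k Q I (u, xs)" and "K2 \<equiv> B2 k Q I (u, xs)"
  shows "direct_family M K1 N1" "direct_family M K2 N2"
    and "submodule_sum M K1 N1 \<inter> submodule_sum M K2 N2 = {\<zero>\<^bsub>M\<^esub>}"
    and "ker u xs = submodule_sum M K1 N1 <+>\<^bsub>M\<^esub> submodule_sum M K2 N2"
proof -
  let ?S1 = "submodule_sum M K1 N1" and ?S2 = "submodule_sum M K2 N2"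
  have u: "u \<in> verts Q" using walk by auto
  have M: "abelian_group M" unfolding M_def by (rule abelian_group_vmod[OF u])
  then interpret M: abelian_group M .
  have walk_\<beta>: "awalk (tail Q \<beta>) (\<beta> # xs) v" if "\<beta> \<in> in_arcs Q u" for \<beta>
    using that walk by (auto simp: awalk_simps)
  have K: "K1 \<subseteq> in_arcs Q u" "K2 \<subseteq> in_arcs Q u" "K1 \<inter> K2 = {}"
    using B2_D[OF walk] by (auto simp: K1_def K2_def B1_eq[OF walk])
  have N2_eq: "N2 \<beta> = amap X \<beta> ` ker (tail Q \<beta>) (\<beta> # xs)" for \<beta>
    by (simp add: N2_def pcomp_def arrow_path_def)
  have N1: "additive_subgroup (N1 \<beta>) M" if "\<beta> \<in> in_arcs Q u" for \<beta>
    unfolding N1_def M_def by (rule im_arrow_additive_subgroup[OF that])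
  have N2: "additive_subgroup (N2 \<beta>) M" if "\<beta> \<in> in_arcs Q u" for \<beta>
    unfolding N2_eq M_def
    by (rule abelian_group_hom.additive_subgroup_image[OF in_arcs_hom ker_additive_subgroup[OF walk_\<beta>]]) (rule that)+
  have N2_N1: "N2 \<beta> \<subseteq> N1 \<beta>" if "\<beta> \<in> in_arcs Q u" for \<beta>
    unfolding N2_eq N1_def im_arrow using mem_ker_iff[OF walk_\<beta>[OF that]] by blast
  have dir: "direct_family M (in_arcs Q u) N1"
    using monic u by (simp add: monic_rep_def M_def N1_def)
  show "direct_family M K1 N1"
    by (rule direct_family_mono[OF M dir K(1)]) simp
  show "direct_family M K2 N2"
    by (rule direct_family_mono[OF M dir K(2)]) (use K(2) N2_N1 in blast)
  \<comment> \<open>\<open>K1\<close> and \<open>K2\<close> are disjoint, so directness of the arrow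
    images over their union separates the two sums, the second one first enlarged from
    \<open>N2\<close> to \<open>N1\<close>.\<close>
  have "direct_family M (K1 \<union> K2) N1"
    by (rule direct_family_mono[OF M dir]) (use K in auto)
  then have "?S1 \<inter> submodule_sum M K2 N1 = {\<zero>\<^bsub>M\<^esub>}"
    by (rule direct_family_Int[OF M]) (use K N1 in blast)+
  moreover have "?S2 \<subseteq> submodule_sum M K2 N1"
    by (rule submodule_sum_mono[OF M]) (use K(2) N2_N1 in blast)
  ultimately show "?S1 \<inter> ?S2 = {\<zero>\<^bsub>M\<^esub>}"
    using zero_in_submodule_sum[OF M, of K1 N1] zero_in_submodule_sum[OF M, of K2 N2] by blast
  have S1: "additive_subgroup ?S1 M" and S2: "additive_subgroup ?S2 M"
    by (rule submodule_sum_additive_subgroup[OF M], use K N1 N2 in blast)+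
  interpret S: additive_subgroup "?S1 <+>\<^bsub>M\<^esub> ?S2" M
    by (rule M.add_additive_subgroups[OF S1 S2])
  interpret S1: additive_subgroup ?S1 M by (rule S1)
  interpret S2: additive_subgroup ?S2 M by (rule S2)
  interpret ker: additive_subgroup "ker u xs" M
    unfolding M_def by (rule ker_additive_subgroup[OF walk])
  have S1_le: "?S1 \<subseteq> ?S1 <+>\<^bsub>M\<^esub> ?S2"
  proof
    fix x assume "x \<in> ?S1"
    moreover from this have "x = x \<oplus>\<^bsub>M\<^esub> \<zero>\<^bsub>M\<^esub>" by simp
    ultimately show "x \<in> ?S1 <+>\<^bsub>M\<^esub> ?S2"
      unfolding set_add_def' using S2.zero_closed by blast
  qed
  have S2_le: "?S2 \<subseteq> ?S1 <+>\<^bsub>M\<^esub> ?S2"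
  proof
    fix x assume "x \<in> ?S2"
    moreover from this have "x = \<zero>\<^bsub>M\<^esub> \<oplus>\<^bsub>M\<^esub> x" by simp
    ultimately show "x \<in> ?S1 <+>\<^bsub>M\<^esub> ?S2"
      unfolding set_add_def' using S1.zero_closed by blast
  qed
  have "ksum u xs \<subseteq> ?S1 <+>\<^bsub>M\<^esub> ?S2"
    unfolding M_def[symmetric]
  proof (rule submodule_sum_least[OF M S.a_subset S.zero_closed S.a_closed])
    fix q assume "q \<in> kernel_paths k Q I (u, xs)"
    from this walk obtain t ys \<beta> where q: "q = (t, ys @ [\<beta>])" "awalk t ys (tail Q \<beta>)" "\<beta> \<in> in_arcs Q u"
      "\<not> null (ys @ [\<beta>])" "null (ys @ \<beta> # xs)"
      by (rule kernel_pathsE)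
    have im_q: "im_path X q = amap X \<beta> ` im_path X (t, ys)"
      by (auto simp: q im_path_def psrc_def pmap_def)
    have im_carrier: "im_path X (t, ys) \<subseteq> carrier (vmod X (tail Q \<beta>))"
      by (rule additive_subgroup.a_subset[OF im_path_additive_subgroup[OF q(2)]])
    show "im_path X q \<subseteq> ?S1 <+>\<^bsub>M\<^esub> ?S2"
    proof (cases "null (\<beta> # xs)")
      case True
      then have \<beta>: "\<beta> \<in> K1" using q by (simp add: K1_def B1_eq[OF walk])
      have "im_path X q \<subseteq> N1 \<beta>"
        using im_carrier by (auto simp: im_q N1_def im_arrow)
      also have "\<dots> \<subseteq> ?S1"
        by (rule submodule_sum_upper[where N = N1, OF M \<beta> additive_subgroup.a_subset[OF N1[OF q(3)]]])
      finally show ?thesis using S1_le by blast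
    next
      case False
      then have \<beta>: "\<beta> \<in> K2"
        unfolding K2_def by (rule B2_I[OF walk q(3) _ q(2,4,5)])
      have "awalk t (ys @ \<beta> # xs) v"
        using q(2) walk_\<beta>[OF q(3)] by auto
      then have "im_path X (t, ys) \<subseteq> ker (tail Q \<beta>) (\<beta> # xs)"
        using im_carrier act_null[OF _ q(5)]
        by (auto simp: mem_ker_iff[OF walk_\<beta>[OF q(3)]] im_path_def psrc_def pmap_def)
      then have "im_path X q \<subseteq> N2 \<beta>"
        unfolding im_q N2_eq by (rule image_mono)
      also have "\<dots> \<subseteq> ?S2"
        by (rule submodule_sum_upper[where N = N2, OF M \<beta> additive_subgroup.a_subset[OF N2[OF q(3)]]])
      finally show ?thesis using S2_le by blast
    qed
  qed
  moreover have "?S1 \<subseteq> ker u xs"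
  proof (rule submodule_sum_least[OF M ker.a_subset ker.zero_closed ker.a_closed])
    fix \<beta> assume "\<beta> \<in> K1"
    then have \<beta>: "\<beta> \<in> in_arcs Q u" "null (\<beta> # xs)"
      by (auto simp: K1_def B1_eq[OF walk])
    show "N1 \<beta> \<subseteq> ker u xs"
      using act_null[OF walk_\<beta>[OF \<beta>(1)] \<beta>(2)] abelian_group_hom.hom_closed[OF in_arcs_hom[OF \<beta>(1)]]
      by (auto simp: N1_def im_arrow mem_ker_iff[OF walk])
  qed
  moreover have "?S2 \<subseteq> ker u xs"
  proof (rule submodule_sum_least[OF M ker.a_subset ker.zero_closed ker.a_closed])
    fix \<beta> assume "\<beta> \<in> K2"
    then have \<beta>: "\<beta> \<in> in_arcs Q u" using K(2) by blast
    show "N2 \<beta> \<subseteq> ker u xs"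
      using abelian_group_hom.hom_closed[OF in_arcs_hom[OF \<beta>]]
      by (auto simp: N2_eq mem_ker_iff[OF walk] mem_ker_iff[OF walk_\<beta>[OF \<beta>]])
  qed
  then have "?S1 <+>\<^bsub>M\<^esub> ?S2 \<subseteq> ker u xs"
    using \<open>?S1 \<subseteq> ker u xs\<close> ker.a_closed unfolding set_add_def' by blast
  ultimately show "ker u xs = ?S1 <+>\<^bsub>M\<^esub> ?S2"
    using ker_eq_ksum[OF walk nn] by blast
qed

text \<open>\<open>B1\<close> and \<open>B2\<close> consist of incoming arrows and are empty at a
  source. Thus both claims of injectivity are the case of \<open>ker_decomposition\<close> with
  empty index sets.\<close>

lemma path_pmap_inj_on:
  assumes "awalk u xs v" "\<not> null xs" "in_arcs Q u = {} \<or> (B1 k Q I (u, xs) = {} \<and> B2 k Q I (u, xs) = {})"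
  shows "inj_on (act xs) (carrier (vmod X u))"
proof (rule inj_on_if_ker_trivial[OF assms(1)])
  have M: "abelian_group (vmod X u)"
    using assms(1) by (auto intro: abelian_group_vmod)
  then interpret M: abelian_group "vmod X u" .
  have "B1 k Q I (u, xs) = {}" "B2 k Q I (u, xs) = {}"
    using assms(3) by (auto simp: B1_def B2_def psrc_def)
  with ker_decomposition(4)[OF assms(1,2)] show "ker u xs = {\<zero>\<^bsub>vmod X u\<^esub>}"
    by (simp add: submodule_sum_empty[OF M] set_add_def')
qed

end

theorem theorem2p3:
  fixes k :: "('k, 'l) ring_scheme"
    and A :: "('k, 'a, 'm) module_scheme"
    and Q :: "('v, 'e) pre_digraph"
    and I :: "(('v, 'e) qpath \<Rightarrow> 'k) set"
    and rho :: "('v, 'e) qpath set"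
    and X :: "('v, 'e, 'a, 'x) quiver_rep"
  assumes "fd_algebra k A"
    and "acyclic_quiver Q"
    and "monomial_ideal k Q I rho"
    and "quiver_representation A Q rho X"
    and "monic_rep k Q I X"
  shows
    "(\<forall>p \<in> paths Q. plen p \<ge> 1 \<and> path_elt k p \<notin> I \<longrightarrow>
        (ker_path Q X p = submodule_sum (vmod X (psrc p)) (kernel_paths k Q I p) (im_path X) \<and>
         (in_arcs Q (psrc p) = {} \<longrightarrow> inj_on (pmap X p) (carrier (vmod X (psrc p)))))
        \<and>
        (let M = vmod X (psrc p);
             N1 = (\<lambda>\<beta>. im_path X (arrow_path Q \<beta>));
             N2 = (\<lambda>\<beta>. amap X \<beta> ` ker_path Q X (pcomp p (arrow_path Q \<beta>)));
             S1 = submodule_sum M (B1 k Q I p) N1;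
             S2 = submodule_sum M (B2 k Q I p) N2
         in direct_family M (B1 k Q I p) N1 \<and>
            direct_family M (B2 k Q I p) N2 \<and>
            S1 \<inter> S2 = {\<zero>\<^bsub>M\<^esub>} \<and>
            ker_path Q X p = S1 <+>\<^bsub>M\<^esub> S2 \<and>
            (B1 k Q I p = {} \<and> B2 k Q I p = {} \<longrightarrow> inj_on (pmap X p) (carrier M))))
     \<and>
     (\<forall>j \<in> verts Q. \<forall>i \<in> verts Q. j \<noteq> i \<longrightarrow>
        direct_family (vmod X i) (nz_paths_from_to k Q I j i) (im_path X))"
proof -
  interpret monic_quiver_rep k A Q I rho X
    using assms by (rule monic_quiver_rep.intro)
  show ?thesis
  proof (intro conjI ballI impI)
    fix p assume p: "p \<in> paths Q" and nz: "1 \<le> plen p \<and> path_elt k p \<notin> I"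
    obtain u xs where p_eq: "p = (u, xs)" by fastforce
    have walk: "awalk u xs (ptgt Q (u, xs))"
      using p by (simp add: mem_paths_iff p_eq)
    have nn: "\<not> null xs"
      using nz path_elt_in_ideal_iff[OF walk] by (simp add: p_eq)
    have src: "psrc (u, xs) = u" and pmap: "pmap X (u, xs) = act xs"
      by (simp_all add: psrc_def pmap_def fun_eq_iff)
    show "ker_path Q X p = submodule_sum (vmod X (psrc p)) (kernel_paths k Q I p) (im_path X)"
      unfolding p_eq src by (rule ker_eq_ksum[OF walk nn])
    show "inj_on (pmap X p) (carrier (vmod X (psrc p)))" if "in_arcs Q (psrc p) = {}"
      using that unfolding p_eq src pmap by (intro path_pmap_inj_on[OF walk nn] disjI1)
    show "let M = vmod X (psrc p);
             N1 = (\<lambda>\<beta>. im_path X (arrow_path Q \<beta>));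
             N2 = (\<lambda>\<beta>. amap X \<beta> ` ker_path Q X (pcomp p (arrow_path Q \<beta>)));
             S1 = submodule_sum M (B1 k Q I p) N1;
             S2 = submodule_sum M (B2 k Q I p) N2
         in direct_family M (B1 k Q I p) N1 \<and>
            direct_family M (B2 k Q I p) N2 \<and>
            S1 \<inter> S2 = {\<zero>\<^bsub>M\<^esub>} \<and>
            ker_path Q X p = S1 <+>\<^bsub>M\<^esub> S2 \<and>
            (B1 k Q I p = {} \<and> B2 k Q I p = {} \<longrightarrow> inj_on (pmap X p) (carrier M))"
      unfolding Let_def p_eq src pmap
      by (intro conjI impI ker_decomposition[OF walk nn] path_pmap_inj_on[OF walk nn] disjI2) simp_all
  qed (rule direct_family_paths)
qed

end
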